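(* Let $A_1,A_2,\dots$ be an arbitrary sequence of random multisubsets of $(0,1]$, with associated ranked sequences $L(1),L(2),\dots$ of elements, and let $T_n=\sum_{a\in A_n}a$ (sum taken with multiplicities). Assume that $$\mathbb{P}(T_n\le 1)=1\quad\text{for every } n,$$ and that for every $k\ge 1$ and every collection of pairwise disjoint closed intervals $I_i=[a_i,b_i]\subset(0,1]$, $i=1,\dots,k$, satisfying $b_1+\cdots+b_k<1$, we have $$\liminf_{n\to\infty}\ \mathbb{E}\prod_{i=1}^k|A_n\cap I_i|\ \ge\ \prod_{i=1}^k\frac{b_i-a_i}{b_i}.$$ Then, as $n\to\infty$, $L(n)$ converges in distribution to the Poisson-Dirichlet process with parameter $\theta=1$. Moreover, the same conclusion holds if, in place of the last displayed inequality, one assumes (for all the same collections of intervals) $$\liminf_{n\to\infty}\ \mathbb{E}\prod_{i=1}^k|A_n\cap I_i|\ \ge\ \prod_{i=1}^k\log\frac{b_i}{a_i}.$$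
   Context: Random multisubsets: a multisubset $A$ of $(0,1]$ assigns to each $u\in(0,1]$ a finite nonnegative integer multiplicity; only at most countable multisets are considered. For $S\subset(0,1]$, $|A\cap S|$ denotes the cardinality of the intersection counted with multiplicities (possibly infinite, but finite for singletons). A random multisubset $A$ is specified by the joint distributions of $|A\cap S_1|,\dots,|A\cap S_k|$ for finite collections of Borel sets $S_i\subset(0,1]$ (equivalently, it is a random $\sigma$-finite integer-valued measure on $(0,1]$). Ranked sequence: $L(n)=(L_1(n),L_2(n),\dots)$, where $L_i(n)$ is the $i$-th largest element of $A_n$ (counting multiplicities) if $i\le|A_n|$, and $L_i(n)=0$ if $i>|A_n|$. Poisson-Dirichlet process PD($\theta$), $\theta>0$: let $U_1,U_2,\dots$ be independent uniform random variables on $(0,1)$, $V_i=U_i^{1/\theta}$, and $G_1=1-V_1$, $G_2=V_1(1-V_2)$, $G_3=V_1V_2(1-V_3),\dots$. Then PD($\theta$) is the distribution of the sequence $L_1\ge L_2\ge\cdots$ obtained by sorting $G_1,G_2,\dots$ into descending order. (Equivalently, it is the Poisson point process with intensity $\theta\,dx/x$ on $(0,1)$ conditioned on the sum of the arrivals being $1$.) Convergence in distribution of sequences means convergence in distribution of the first $k$ coordinates for every $k$. *)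

theory Defs
  imports "HOL-Probability.Probability"
begin

text \<open>A multisubset of \<open>(0,1]\<close> is represented by its multiplicity function
  \<open>real \<Rightarrow> nat\<close>, vanishing outside \<open>(0,1]\<close>.\<close>

definition multisubset :: "(real \<Rightarrow> nat) \<Rightarrow> bool" where
  "multisubset m \<longleftrightarrow> countable {u. m u \<noteq> 0} \<and> {u. m u \<noteq> 0} \<subseteq> {0<..1}"

definition mcard :: "(real \<Rightarrow> nat) \<Rightarrow> real set \<Rightarrow> ennreal" where
  "mcard m S = (\<integral>\<^sup>+u. of_nat (m u) \<partial>count_space S)"

definition msum :: "(real \<Rightarrow> nat) \<Rightarrow> ennreal" where
  "msum m = (\<integral>\<^sup>+u. of_nat (m u) * ennreal u \<partial>count_space {0<..1})"

definition random_multisubset :: "'a measure \<Rightarrow> ('a \<Rightarrow> real \<Rightarrow> nat) \<Rightarrow> bool" where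
  "random_multisubset M A \<longleftrightarrow>
     prob_space M \<and>
     (\<forall>\<omega>\<in>space M. multisubset (A \<omega>)) \<and>
     (\<forall>S\<in>sets borel. S \<subseteq> {0<..1} \<longrightarrow> (\<lambda>\<omega>. mcard (A \<omega>) S) \<in> borel_measurable M)"

text \<open>Positions are counted from \<open>0\<close>: \<open>ranked m i\<close> is the \<open>(i+1)\<close>-st largest element of \<open>m\<close>
  with multiplicity, i.e. the \<open>x\<close> such that at most \<open>i\<close> elements exceed \<open>x\<close> while more than \<open>i\<close>
  elements are at least \<open>x\<close>, and it is \<open>0\<close> if \<open>m\<close> has at most \<open>i\<close> elements. If \<open>m\<close> has infinitely
  many elements above some positive level, it has no descending enumeration and the value is \<open>0\<close>
  by convention; this cannot happen when the sum of the elements is finite.\<close>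

definition ranked :: "(real \<Rightarrow> nat) \<Rightarrow> nat \<Rightarrow> real" where
  "ranked m i =
     (if (\<forall>x>0. mcard m {x..1} < \<infinity>) \<and> of_nat i < mcard m {0<..1}
      then THE x. x \<in> {0<..1} \<and> mcard m {x<..1} \<le> of_nat i \<and> of_nat i < mcard m {x..1}
      else 0)"

definition uniform01_seq :: "(nat \<Rightarrow> real) measure" where
  "uniform01_seq = (\<Pi>\<^sub>M i\<in>UNIV. restrict_space lborel {0<..<1})"

definition stick_breaking :: "real \<Rightarrow> (nat \<Rightarrow> real) \<Rightarrow> nat \<Rightarrow> real" where
  "stick_breaking \<theta> u i = (\<Prod>j<i. u j powr (1 / \<theta>)) * (1 - u i powr (1 / \<theta>))"

text \<open>The law of the sequence obtained by sorting the stick-breaking sequence \<open>G\<close> in descending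
  order, as a measure on sequences with the product topology. For \<open>u\<close> in \<open>(0,1)\<^sup>\<nat>\<close> the entries
  of \<open>G\<close> are positive with sum at most \<open>1\<close>, so every value is attained finitely often and \<open>card\<close>
  is the true multiplicity.\<close>

definition poisson_dirichlet :: "real \<Rightarrow> (nat \<Rightarrow> real) measure" where
  "poisson_dirichlet \<theta> =
     distr uniform01_seq borel (\<lambda>u. ranked (\<lambda>x. card {i. stick_breaking \<theta> u i = x}))"

text \<open>Convergence in distribution of the first \<open>k\<close> coordinates for every \<open>k\<close>, by bounded continuous
  test functions; \<open>\<real>\<^sup>k\<close> is \<open>{..<k} \<rightarrow>\<^sub>E UNIV\<close> with the product topology.\<close>

definition seq_converges_in_distribution ::
  "(nat \<Rightarrow> 'a measure) \<Rightarrow> (nat \<Rightarrow> 'a \<Rightarrow> nat \<Rightarrow> real) \<Rightarrow> (nat \<Rightarrow> real) measure \<Rightarrow> bool" where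
  "seq_converges_in_distribution M X Q \<longleftrightarrow>
     (\<forall>n. X n \<in> measurable (M n) borel) \<and>
     (\<forall>k. \<forall>g :: (nat \<Rightarrow> real) \<Rightarrow> real.
        continuous_on ({..<k} \<rightarrow>\<^sub>E UNIV) g \<and> bounded (g ` ({..<k} \<rightarrow>\<^sub>E UNIV)) \<longrightarrow>
        (\<lambda>n. \<integral>\<omega>. g (restrict (X n \<omega>) {..<k}) \<partial>M n)
          \<longlonglongrightarrow> (\<integral>x. g (restrict x {..<k}) \<partial>Q))"

definition admissible_intervals :: "nat \<Rightarrow> (nat \<Rightarrow> real) \<Rightarrow> (nat \<Rightarrow> real) \<Rightarrow> bool" where
  "admissible_intervals k a b \<longleftrightarrow>
     (\<forall>i<k. a i \<le> b i \<and> {a i..b i} \<subseteq> {0<..1}) \<and>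
     disjoint_family_on (\<lambda>i. {a i..b i}) {..<k} \<and>
     (\<Sum>i<k. b i) < 1"

end

theory Submission
  imports Defs
begin

text \<open>
  Let \<open>G\<close> be the stick-breaking sequence. By portmanteau-type approximation it suffices to show
  \<open>liminf E H(L(n)) \<ge> E H(L)\<close> for bounded continuous \<open>H \<ge> 0\<close>, where \<open>L\<close> is \<open>G\<close> sorted.

  Cut \<open>(0,1]\<close> into cells \<open>(l/N, (l+1)/N]\<close>. For a tuple \<open>j\<close> of \<open>k\<close> distinct cells let
  \<open>w(j) = \<Prod>\<^sub>i j\<^sub>i / (N - j\<^sub>0 - \<dots> - j\<^sub>i\<^sub>-\<^sub>1)\<close>, a lower bound for the chance that size-biased sampling
  picks given elements of these cells in this order. For any multiset of total mass at most 1 the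
  weighted tuple counts \<open>\<Sum>\<^sub>j w(j) \<Prod>\<^sub>i |A \<inter> cell j\<^sub>i|\<close> are at most 1. Hence \<open>E H(L(n))\<close> is at
  least the sum over \<open>j\<close> of \<open>w(j) E \<Prod>\<^sub>i |A\<^sub>n \<inter> cell j\<^sub>i|\<close> times the infimum of \<open>H\<close> over the ranked
  sequences of multisets that meet all cells of \<open>j\<close>. By hypothesis and up to factors tending to 1,
  \<open>w(j) E \<Prod>\<^sub>i |A\<^sub>n \<inter> cell j\<^sub>i|\<close> is at least the probability that \<open>G\<^sub>0, \<dots>, G\<^sub>k\<^sub>-\<^sub>1\<close> lie in these cells.
  Finally, with high probability \<open>G\<^sub>0, \<dots>, G\<^sub>k\<^sub>-\<^sub>1\<close> carry nearly all the mass, and then the cells determine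
  the ranked sequence up to a small error, so the sum is close to \<open>E H(L)\<close>. The logarithmic
  hypothesis implies the other one.
\<close>

section \<open>Multisets and ranked sequences\<close>

text \<open>Exhibits \<open>mcard m\<close> as a measure, so that monotonicity, subadditivity and
  continuity from below come from measure theory.\<close>

lemma mcard_eq_emeasure:
  "mcard m S = emeasure (density (count_space UNIV) (\<lambda>u. of_nat (m u))) S"
  unfolding mcard_def
  by (subst emeasure_density) (auto simp: nn_integral_count_space_indicator)

lemma mcard_mono: "S \<subseteq> S' \<Longrightarrow> mcard m S \<le> mcard m S'"
  unfolding mcard_eq_emeasure by (rule emeasure_mono) auto

lemma mcard_subadditive: "mcard m (S \<union> S') \<le> mcard m S + mcard m S'"
  unfolding mcard_eq_emeasure by (rule emeasure_subadditive) auto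

lemma mcard_UN_disjoint:
  "finite I \<Longrightarrow> disjoint_family_on S I \<Longrightarrow> mcard m (\<Union>i\<in>I. S i) = (\<Sum>i\<in>I. mcard m (S i))"
  unfolding mcard_eq_emeasure by (rule sum_emeasure[symmetric]) auto

text \<open>A nonzero multiplicity is at least 1, so the counting measure of the support inside
  \<open>S\<close> is dominated by \<open>mcard m S\<close>.\<close>

lemma mcard_finite_support:
  assumes "mcard m S < \<infinity>"
  shows "finite {u\<in>S. m u \<noteq> 0}" "mcard m S = of_nat (\<Sum>u\<in>{u\<in>S. m u \<noteq> 0}. m u)"
proof -
  have "emeasure (count_space UNIV) {u\<in>S. m u \<noteq> 0} \<le> mcard m S"
  proof -
    have "emeasure (count_space UNIV) {u\<in>S. m u \<noteq> 0} = (\<integral>\<^sup>+u. indicator {u\<in>S. m u \<noteq> 0} u \<partial>count_space UNIV)"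
      by (rule nn_integral_indicator[symmetric]) simp
    also have "\<dots> \<le> (\<integral>\<^sup>+u. of_nat (m u) * indicator S u \<partial>count_space UNIV)"
      by (rule nn_integral_mono)
        (auto simp: indicator_def intro: order_trans[OF _ of_nat_mono[OF Suc_leI]])
    finally show ?thesis by (simp add: mcard_def nn_integral_count_space_indicator)
  qed
  with assms show *: "finite {u\<in>S. m u \<noteq> 0}"
    by (auto simp: emeasure_count_space_infinite top.extremum_unique intro: ccontr)
  show "mcard m S = of_nat (\<Sum>u\<in>{u\<in>S. m u \<noteq> 0}. m u)"
    unfolding mcard_def by (subst nn_integral_count_space'[OF *]) auto
qed

lemma mcard_nat:
  assumes "mcard m S < \<infinity>"
  obtains c :: nat where "mcard m S = of_nat c"
  using mcard_finite_support(2)[OF assms] by blast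

text \<open>A Markov-type inequality: interchanging the sums weighs each element \<open>u\<close>
  with a step function that stays below \<open>u\<close>, and adding up the elements themselves
  gives \<open>msum m\<close>.\<close>

lemma sum_mcard_le_msum:
  assumes "finite I" "\<And>i. i \<in> I \<Longrightarrow> S i \<subseteq> {0<..1}"
    and le: "\<And>u. u \<in> {0<..1} \<Longrightarrow> (\<Sum>i\<in>I. w i * indicator (S i) u) \<le> ennreal u"
  shows "(\<Sum>i\<in>I. w i * mcard m (S i)) \<le> msum m"
proof -
  have "mcard m (S i) = (\<integral>\<^sup>+u. of_nat (m u) * indicator (S i) u \<partial>count_space {0<..1})" if "i \<in> I" for i
    unfolding mcard_def
    using assms(2)[OF that]
    by (subst (1 2) nn_integral_count_space_indicator) (auto intro!: nn_integral_cong simp: indicator_def)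
  then have "(\<Sum>i\<in>I. w i * mcard m (S i)) =
      (\<integral>\<^sup>+u. (\<Sum>i\<in>I. w i * (of_nat (m u) * indicator (S i) u)) \<partial>count_space {0<..1})"
    by (simp add: nn_integral_sum nn_integral_cmult)
  also have "\<dots> = (\<integral>\<^sup>+u. of_nat (m u) * (\<Sum>i\<in>I. w i * indicator (S i) u) \<partial>count_space {0<..1})"
    by (simp add: sum_distrib_left ac_simps)
  also have "\<dots> \<le> msum m"
    unfolding msum_def by (intro nn_integral_mono mult_left_mono le) auto
  finally show ?thesis .
qed

lemma mult_mcard_le_msum: "0 \<le> y \<Longrightarrow> ennreal y * mcard m {y<..1} \<le> msum m"
  using sum_mcard_le_msum[of "{()}" "\<lambda>_. {y<..1}" "\<lambda>_. ennreal y" m]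
  by (force simp: indicator_def intro: ennreal_leI)

definition finite_tails :: "(real \<Rightarrow> nat) \<Rightarrow> bool" where
  "finite_tails m \<longleftrightarrow> (\<forall>x>0. mcard m {x..1} < \<infinity>)"

lemma finite_tails_mcard: "finite_tails m \<Longrightarrow> S \<subseteq> {x..1} \<Longrightarrow> 0 < x \<Longrightarrow> mcard m S < \<infinity>"
  unfolding finite_tails_def using mcard_mono order.strict_trans1 by blast

text \<open>Markov's inequality at level \<open>x/2\<close>; halving turns the closed end
  \<open>x\<close> into the open end used by \<open>mult_mcard_le_msum\<close>.\<close>

lemma finite_tails_if_msum_finite:
  assumes "msum m < \<infinity>"
  shows "finite_tails m"
  unfolding finite_tails_def
proof safe
  fix x :: real assume x: "0 < x"
  have "ennreal (x/2) * mcard m {x..1} \<le> ennreal (x/2) * mcard m {x/2<..1}"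
    using x by (intro mult_left_mono mcard_mono) auto
  also have "\<dots> \<le> msum m" using x by (intro mult_mcard_le_msum) auto
  finally have "ennreal (x/2) * mcard m {x..1} < \<infinity>" using assms by (rule le_less_trans)
  then show "mcard m {x..1} < \<infinity>" using x
    by (auto simp: ennreal_mult_less_top ennreal_eq_0_iff)
qed

text \<open>The smallest support point in \<open>S\<close> works: all elements in \<open>S\<close>
  are at or above it.\<close>

lemma mcard_attained:
  assumes "mcard m S < \<infinity>" "of_nat i < mcard m S" "S \<subseteq> {0<..1}"
  obtains z where "z \<in> S" "m z \<noteq> 0" "of_nat i < mcard m {z..1}"
proof -
  let ?F = "{u\<in>S. m u \<noteq> 0}"
  have fin: "finite ?F" and eq: "mcard m S = of_nat (\<Sum>u\<in>?F. m u)"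
    using mcard_finite_support[OF assms(1)] by auto
  have ne: "?F \<noteq> {}" using assms(2) eq by (metis gr_implies_not_zero of_nat_0 sum.empty)
  have "of_nat i < mcard m S" by fact
  also have "mcard m S = mcard m ?F"
    unfolding mcard_def by (subst (1 2) nn_integral_count_space'[OF fin]) auto
  also have "\<dots> \<le> mcard m {Min ?F..1}"
    using fin assms(3) by (intro mcard_mono) auto
  finally show ?thesis using that[of "Min ?F"] Min_in[OF fin ne] by auto
qed

text \<open>Justifies the definite description in \<open>ranked\<close>. The value is the largest
  support point with more than \<open>i\<close> elements at or above it. It is unique, since for
  candidates \<open>a < b\<close> the tail from \<open>b\<close> on is contained in the open tail
  above \<open>a\<close>.\<close>

lemma ranked_pos_properties:
  assumes ft: "finite_tails m" and i: "of_nat i < mcard m {0<..1}"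
  shows "ranked m i \<in> {0<..1} \<and> mcard m {ranked m i<..1} \<le> of_nat i \<and> of_nat i < mcard m {ranked m i..1}"
proof -
  let ?P = "\<lambda>x. x \<in> {0<..1} \<and> mcard m {x<..1} \<le> of_nat i \<and> of_nat i < mcard m {x..1}"
  \<comment> \<open>Continuity from below provides a positive level \<open>y\<close> with more than
    \<open>i\<close> elements above it; beyond \<open>y\<close> the support is finite, so a maximum
    exists.\<close>
  have "(\<lambda>n. mcard m {1/real (Suc n)..1}) \<longlonglongrightarrow> mcard m (\<Union>n. {1/real (Suc n)..1})"
    unfolding mcard_eq_emeasure
    by (rule Lim_emeasure_incseq) (auto simp: incseq_def field_simps intro: order_trans[rotated] frac_le)
  also have "(\<Union>n. {1/real (Suc n)..1}) = {0<..(1::real)}"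
  proof safe
    fix x :: real assume "x \<in> {0<..1}"
    then obtain n where "inverse (real (Suc n)) < x" using reals_Archimedean by auto
    then show "x \<in> (\<Union>n. {1/real (Suc n)..1})" using \<open>x \<in> {0<..1}\<close>
      by (auto simp: inverse_eq_divide intro!: exI[of _ n])
  qed (auto intro: less_le_trans[rotated])
  finally have "eventually (\<lambda>n. of_nat i < mcard m {1/real (Suc n)..1}) sequentially"
    using i by (rule order_tendstoD)
  then obtain n where n: "of_nat i < mcard m {1/real (Suc n)..1}"
    by (auto simp: eventually_sequentially)
  define y where "y = 1/real (Suc n)"
  have y: "0 < y" "of_nat i < mcard m {y..1}" using n by (auto simp: y_def)
  have fin: "mcard m {y..1} < \<infinity>" using ft y by (auto simp: finite_tails_def)
  define Z where "Z = {u\<in>{y..1}. m u \<noteq> 0 \<and> of_nat i < mcard m {u..1}}"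
  have "finite Z" using mcard_finite_support(1)[OF fin] by (rule rev_finite_subset) (auto simp: Z_def)
  have "{y..1} \<subseteq> {0<..1}" using y by auto
  then have "Z \<noteq> {}" using mcard_attained[OF fin y(2)] by (auto simp: Z_def)
  define x where "x = Max Z"
  have xZ: "x \<in> Z" unfolding x_def using \<open>finite Z\<close> \<open>Z \<noteq> {}\<close> by simp
  have Px: "?P x"
  proof (intro conjI)
    show "x \<in> {0<..1}" "of_nat i < mcard m {x..1}" using xZ y by (auto simp: Z_def)
    \<comment> \<open>Otherwise \<open>mcard_attained\<close> produces a point of \<open>Z\<close>
      above its maximum \<open>x\<close>.\<close>
    show "mcard m {x<..1} \<le> of_nat i"
    proof (rule ccontr)
      assume a: "\<not> mcard m {x<..1} \<le> of_nat i"
      have "y \<le> x" using xZ by (auto simp: Z_def)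
      then have "mcard m {x<..1} < \<infinity>" "{x<..1} \<subseteq> {0<..1}"
        using y by (auto intro!: finite_tails_mcard[OF ft _ y(1), simplified])
      then obtain z where "z \<in> {x<..1}" "m z \<noteq> 0" "of_nat i < mcard m {z..1}"
        using a mcard_attained[of m "{x<..1}" i] by (auto simp: not_le)
      then have "z \<in> Z" "x < z" using xZ by (auto simp: Z_def)
      then show False using Max_ge[OF \<open>finite Z\<close>] by (simp add: x_def leD)
    qed
  qed
  have uniq: "x' = x" if "?P x'" for x'
  proof (rule ccontr)
    have "\<not> (?P a \<and> ?P b \<and> a < b)" for a b
    proof safe
      assume "of_nat i < mcard m {b..1}" "mcard m {a<..1} \<le> of_nat i" "a < b"
      moreover have "mcard m {b..1} \<le> mcard m {a<..1}" using \<open>a < b\<close> by (intro mcard_mono) auto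
      ultimately show False by (meson leD order.strict_trans2)
    qed
    moreover assume "x' \<noteq> x"
    ultimately show False using Px that by (metis linorder_less_linear)
  qed
  have "?P (THE x. ?P x)" by (rule theI[of ?P x]) (fact Px, fact uniq)
  moreover have "ranked m i = (THE x. ?P x)" using ft i by (simp add: ranked_def finite_tails_def)
  ultimately show ?thesis by simp
qed

lemma ranked_bounds: "0 \<le> ranked m i" "ranked m i \<le> 1"
proof -
  have "0 \<le> ranked m i \<and> ranked m i \<le> 1"
  proof (cases "finite_tails m \<and> of_nat i < mcard m {0<..1}")
    case True then show ?thesis using ranked_pos_properties[of m i] by auto
  next
    case False
    then have "ranked m i = 0" unfolding ranked_def finite_tails_def by (metis (no_types, lifting))
    then show ?thesis by simp
  qed
  then show "0 \<le> ranked m i" "ranked m i \<le> 1" by auto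
qed

text \<open>Replaces the description in \<open>ranked\<close> by a counting condition, on which both
  measurability and the comparison of two multisets rest. Where the convention value 0 applies, both
  sides fail because \<open>y\<close> is positive.\<close>

lemma le_ranked_iff:
  assumes "0 < y"
  shows "y \<le> ranked m i \<longleftrightarrow> finite_tails m \<and> of_nat i < mcard m {y..1}"
proof (cases "finite_tails m \<and> of_nat i < mcard m {0<..1}")
  case True
  note r = ranked_pos_properties[OF conjunct1[OF True] conjunct2[OF True]]
  have "of_nat i < mcard m {y..1}" if "y \<le> ranked m i"
  proof -
    have "mcard m {ranked m i..1} \<le> mcard m {y..1}" using that by (intro mcard_mono) auto
    then show ?thesis using r by auto
  qed
  moreover have "\<not> of_nat i < mcard m {y..1}" if "\<not> y \<le> ranked m i"
  proof -
    have "mcard m {y..1} \<le> mcard m {ranked m i<..1}" using that by (intro mcard_mono) auto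
    then show ?thesis using r by auto
  qed
  ultimately show ?thesis using True by blast
next
  case False
  then have "ranked m i = 0" unfolding ranked_def finite_tails_def by (metis (no_types, lifting))
  moreover have "mcard m {y..1} \<le> mcard m {0<..1}" using assms by (intro mcard_mono) auto
  ultimately show ?thesis using False assms by (auto dest: order.strict_trans2)
qed

text \<open>For \<open>y > 0\<close> the superlevel sets are counting events by
  \<open>le_ranked_iff\<close>; for other \<open>y\<close> they are the whole space.\<close>

lemma ranked_measurable:
  assumes "random_multisubset M A"
  shows "(\<lambda>\<omega>. ranked (A \<omega>)) \<in> borel_measurable M"
proof (rule measurable_coordinatewise_then_product)
  fix i
  have meas[measurable]: "S \<in> sets borel \<Longrightarrow> S \<subseteq> {0<..1} \<Longrightarrow> (\<lambda>\<omega>. mcard (A \<omega>) S) \<in> borel_measurable M" for S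
    using assms by (auto simp: random_multisubset_def)
  \<comment> \<open>The condition ranges over uncountably many levels; the levels
    \<open>1/(n+1)\<close> suffice by monotonicity.\<close>
  have tails: "finite_tails m \<longleftrightarrow> (\<forall>n. mcard m {1/real (Suc n)..1} < \<infinity>)" for m
  proof
    assume *: "\<forall>n. mcard m {1/real (Suc n)..1} < \<infinity>"
    show "finite_tails m" unfolding finite_tails_def
    proof safe
      fix x :: real assume "0 < x"
      then obtain n where n: "inverse (real (Suc n)) < x" using reals_Archimedean by auto
      then have "mcard m {x..1} \<le> mcard m {1/real (Suc n)..1}"
        by (intro mcard_mono) (auto simp: inverse_eq_divide)
      with * show "mcard m {x..1} < \<infinity>" by (meson order.strict_trans1)
    qed
  qed (auto simp: finite_tails_def)
  show "(\<lambda>\<omega>. ranked (A \<omega>) i) \<in> borel_measurable M"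
    unfolding borel_measurable_iff_ge
  proof
    fix y :: real
    show "{\<omega> \<in> space M. y \<le> ranked (A \<omega>) i} \<in> sets M"
    proof (cases "0 < y")
      case True
      have [measurable]: "(\<lambda>\<omega>. mcard (A \<omega>) {1/real (Suc n)..1}) \<in> borel_measurable M" for n
      proof (rule meas)
        have "0 < 1 / real (Suc n)" by simp
        then show "{1/real (Suc n)..1} \<subseteq> {0<..1}"
          by (metis atLeastAtMost_iff greaterThanAtMost_iff less_le_trans subsetI)
      qed simp
      have [measurable]: "(\<lambda>\<omega>. mcard (A \<omega>) {y..1}) \<in> borel_measurable M"
        using True by (intro meas) auto
      show ?thesis unfolding le_ranked_iff[OF True] tails by measurable
    next
      case False
      then have "y \<le> ranked m i" for m using ranked_bounds(1)[of m i] by linarith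
      then show ?thesis by simp
    qed
  qed
qed

text \<open>Both multisets have an element in each cell, and these elements exhaust the total mass up to
  \<open>d\<close>. So an element exceeding \<open>d\<close> must be one of the chosen ones, and these are close in pairs.\<close>
lemma ranked_le_ranked_plus:
  fixes k :: nat
  assumes ms: "msum m \<le> 1" "msum m' \<le> 1"
    and ab: "\<And>i. i < k \<Longrightarrow> 0 < a i \<and> a i < b i \<and> b i \<le> a i + h \<and> b i \<le> 1"
    and disj: "disjoint_family_on (\<lambda>i. {a i<..b i}) {..<k}"
    and sum: "1 - d \<le> (\<Sum>i<k. a i)" and "0 \<le> d" "0 \<le> h"
    and hit: "\<And>i. i < k \<Longrightarrow> mcard m {a i<..b i} \<noteq> 0"
      "\<And>i. i < k \<Longrightarrow> mcard m' {a i<..b i} \<noteq> 0"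
  shows "ranked m r \<le> ranked m' r + d + h"
proof (cases "ranked m r \<le> d + h")
  case True
  then show ?thesis using ranked_bounds(1)[of m' r] by simp
next
  case False
  define x where "x = ranked m r"
  \<comment> \<open>Cells have width at most \<open>h\<close>, so a cell reaching up to
    \<open>x\<close> starts at \<open>s\<close> or later. The case assumption makes
    \<open>s > d\<close>.\<close>
  define s where "s = x - h"
  have s: "d < s" "0 < s" "0 < x" "x \<le> 1" using False assms(6,7) ranked_bounds(2)[of m r]
    by (auto simp: x_def s_def)
  define J where "J i = {a i<..b i}" for i
  \<comment> \<open>The elements of size at least \<open>x\<close> lie in the cells of
    \<open>D\<close> or, outside these, in \<open>X\<close>.\<close>
  define D where "D = {i\<in>{..<k}. x \<le> b i}"
  define X where "X = {x..1} - (\<Union>i\<in>D. J i)"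
  have ft: "finite_tails m" "finite_tails m'"
    using ms by (auto intro!: finite_tails_if_msum_finite elim: order.strict_trans1)
  have D: "D \<subseteq> {..<k}" by (auto simp: D_def)
  then have "finite D" by (rule finite_subset) simp
  note D = D this
  have disjJ: "disjoint_family_on J D" "disjoint_family_on J {..<k}"
    using disj D by (auto simp: J_def[abs_def] disjoint_family_on_def)
  have aD: "s \<le> a i" if "i \<in> D" for i using that ab[of i] by (auto simp: D_def s_def)
  have fJ: "mcard m (J i) < \<infinity>" if "i < k" for i
    using ab[OF that] by (intro finite_tails_mcard[OF ft(1), of _ "a i"]) (auto simp: J_def)
  have fX: "mcard m X < \<infinity>"
    using s by (intro finite_tails_mcard[OF ft(1), of _ x]) (auto simp: X_def)
  have "\<exists>c::nat. mcard m (J i) = of_nat c" if "i < k" for i using mcard_nat[OF fJ[OF that]] by metis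
  then obtain c :: "nat \<Rightarrow> nat" where c: "\<And>i. i < k \<Longrightarrow> mcard m (J i) = of_nat (c i)" by metis
  have c1: "1 \<le> c i" if "i < k" for i using hit(1)[OF that] c[OF that] by (auto simp: J_def)
  obtain e :: nat where e: "mcard m X = of_nat e" using mcard_nat[OF fX] by metis
  \<comment> \<open>The mass is bounded from below by weight \<open>a i\<close> on cell
    \<open>i\<close> and weight \<open>s\<close> on \<open>X\<close>; the extra index
    \<open>k\<close> stands for \<open>X\<close>.\<close>
  have "(\<Sum>i\<in>{..k}. ennreal (if i < k then a i else s) * mcard m (if i < k then J i else X)) \<le> msum m"
  proof (rule sum_mcard_le_msum)
    fix u :: real assume u: "u \<in> {0<..1}"
    show "(\<Sum>i\<le>k. ennreal (if i < k then a i else s) * indicator (if i < k then J i else X) u) \<le> ennreal u"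
    proof (cases "\<exists>i<k. u \<in> J i")
      case True
      then obtain i where i: "i < k" "u \<in> J i" by blast
      have "u \<notin> X" using i by (auto simp: X_def D_def J_def)
      moreover have "indicator (J l) u = (if l = i then 1 else 0 :: ennreal)" if "l < k" for l
        using i that disjJ(2) by (auto simp: disjoint_family_on_def indicator_def)
      ultimately have "(\<Sum>l\<le>k. ennreal (if l < k then a l else s) * indicator (if l < k then J l else X) u)
          = (\<Sum>l\<le>k. if l = i then ennreal (a i) else 0)"
        using i by (intro sum.cong) auto
      also have "\<dots> = ennreal (a i)" using i by simp
      also have "\<dots> \<le> ennreal u" using i by (auto simp: J_def intro: ennreal_leI)
      finally show ?thesis .
    next
      case False
      then have "(\<Sum>l\<le>k. ennreal (if l < k then a l else s) * indicator (if l < k then J l else X) u)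
          = (\<Sum>l\<le>k. if l = k then ennreal s * indicator X u else 0)"
        by (intro sum.cong) auto
      also have "\<dots> \<le> ennreal u"
        using assms(7) by (auto simp: indicator_def X_def s_def intro!: ennreal_leI)
      finally show ?thesis .
    qed
  qed (use ab s in \<open>auto simp: J_def X_def split: if_splits; force\<close>)+
  also have "(\<Sum>i\<in>{..k}. ennreal (if i < k then a i else s) * mcard m (if i < k then J i else X))
    = (\<Sum>i<k. ennreal (a i * c i)) + ennreal (s * e)"
    using ab s by (simp add: lessThan_Suc_atMost[symmetric] c e ennreal_mult less_imp_le ennreal_of_nat_eq_real_of_nat)
  also have "\<dots> = ennreal ((\<Sum>i<k. a i * c i) + s * e)"
  proof -
    have "0 \<le> a i * real (c i)" if "i < k" for i using ab[OF that] by auto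
    then show ?thesis using s
      by (subst sum_ennreal) (auto intro!: ennreal_plus[symmetric] sum_nonneg)
  qed
  finally have "ennreal ((\<Sum>i<k. a i * c i) + s * e) \<le> 1" using ms(1) by (rule order_trans)
  then have le1: "(\<Sum>i<k. a i * c i) + s * e \<le> 1" by simp
  \<comment> \<open>One element in each cell already accounts for mass \<open>1 - d\<close>. Every
    further element in a cell of \<open>D\<close> or in \<open>X\<close> costs at least
    \<open>s\<close>.\<close>
  have "(\<Sum>i<k. a i) + (\<Sum>i\<in>D. s * (real (c i) - 1)) \<le> (\<Sum>i<k. a i) + (\<Sum>i\<in>D. a i * (real (c i) - 1))"
    using c1 D aD by (intro add_left_mono sum_mono mult_right_mono) auto
  also have "\<dots> \<le> (\<Sum>i<k. a i) + (\<Sum>i<k. a i * (real (c i) - 1))"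
    using c1 D ab by (intro add_left_mono sum_mono2) (auto intro!: mult_nonneg_nonneg intro: less_imp_le)
  also have "\<dots> = (\<Sum>i<k. a i * c i)" by (simp add: algebra_simps flip: sum.distrib)
  finally have "(1 - d) + s * ((\<Sum>i\<in>D. real (c i)) - card D + e) \<le> 1"
    using le1 sum by (simp add: algebra_simps sum_subtractf sum_distrib_left)
  then have *: "s * ((\<Sum>i\<in>D. real (c i)) - card D + e) \<le> d" by simp
  \<comment> \<open>A single surplus element would cost \<open>s > d\<close>, so the elements of
    \<open>m\<close> from \<open>x\<close> on number at most \<open>card D\<close>.\<close>
  have "(\<Sum>i\<in>D. c i) + e \<le> card D"
  proof (rule ccontr)
    assume "\<not> ?thesis"
    then have "real (card D + 1) \<le> real ((\<Sum>i\<in>D. c i) + e)" by (intro of_nat_mono) simp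
    then have "1 \<le> (\<Sum>i\<in>D. real (c i)) - card D + e" by simp
    then have "s * 1 \<le> s * ((\<Sum>i\<in>D. real (c i)) - card D + e)" using s by (intro mult_left_mono) auto
    with * s show False by simp
  qed
  have "of_nat r < mcard m {x..1}"
    using le_ranked_iff[OF s(3), of m r] by (auto simp: x_def)
  also have "\<dots> \<le> mcard m ((\<Union>i\<in>D. J i) \<union> X)" by (rule mcard_mono) (auto simp: X_def)
  also have "\<dots> \<le> mcard m (\<Union>i\<in>D. J i) + mcard m X" by (rule mcard_subadditive)
  also have "\<dots> = of_nat ((\<Sum>i\<in>D. c i) + e)"
    using D by (subst mcard_UN_disjoint[OF D(2) disjJ(1)]) (auto simp: e intro!: sum.cong c)
  also have "\<dots> \<le> of_nat (card D)" using \<open>(\<Sum>i\<in>D. c i) + e \<le> card D\<close> by (rule of_nat_mono)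
  also have "\<dots> = (\<Sum>i\<in>D. 1 :: ennreal)" by simp
  \<comment> \<open>Each cell of \<open>D\<close> holds an element of \<open>m'\<close>, and all
    these elements are at least \<open>s\<close>.\<close>
  also have "\<dots> \<le> (\<Sum>i\<in>D. mcard m' (J i))"
  proof (rule sum_mono)
    fix i assume i: "i \<in> D"
    then have "i < k" using D by auto
    have "mcard m' (J i) < \<infinity>"
      using ab[OF \<open>i<k\<close>] by (intro finite_tails_mcard[OF ft(2), of _ "a i"]) (auto simp: J_def)
    then obtain c' :: nat where "mcard m' (J i) = of_nat c'" by (rule mcard_nat)
    then show "1 \<le> mcard m' (J i)" using hit(2)[OF \<open>i<k\<close>]
      by (cases c') (auto simp: J_def)
  qed
  also have "\<dots> = mcard m' (\<Union>i\<in>D. J i)" by (rule mcard_UN_disjoint[OF D(2) disjJ(1), symmetric])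
  also have "\<dots> \<le> mcard m' {s..1}"
    using aD ab D by (intro mcard_mono) (force simp: J_def)
  finally have "s \<le> ranked m' r" using ft s by (simp add: le_ranked_iff)
  then show ?thesis using assms(6) by (simp add: s_def x_def)
qed

lemma ranked_dist_le:
  fixes k :: nat
  assumes "msum m \<le> 1" "msum m' \<le> 1"
    and "\<And>i. i < k \<Longrightarrow> 0 < a i \<and> a i < b i \<and> b i \<le> a i + h \<and> b i \<le> 1"
    and "disjoint_family_on (\<lambda>i. {a i<..b i}) {..<k}"
    and "1 - d \<le> (\<Sum>i<k. a i)" and "0 \<le> d" "0 \<le> h"
    and "\<And>i. i < k \<Longrightarrow> mcard m {a i<..b i} \<noteq> 0"
      "\<And>i. i < k \<Longrightarrow> mcard m' {a i<..b i} \<noteq> 0"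
  shows "dist (ranked m r) (ranked m' r) \<le> d + h"
  using ranked_le_ranked_plus[of m m' k a b h d r] ranked_le_ranked_plus[of m' m k a b h d r] assms
  by (simp add: dist_real_def abs_le_iff)

section \<open>Stick breaking\<close>

text \<open>Passes from a sum over values with multiplicity to a sum over indices: the fiber size is
  a sum of indicators, and the two sums are interchanged.\<close>

lemma nn_integral_card_fibers:
  fixes g :: "nat \<Rightarrow> 'b"
  assumes fin: "\<And>x. finite {i. g i = x}"
  shows "(\<integral>\<^sup>+x. of_nat (card {i. g i = x}) * h x \<partial>count_space S) = (\<Sum>i. h (g i) * indicator S (g i))"
proof -
  have card: "(of_nat (card {i. g i = x}) :: ennreal) = (\<Sum>i. indicator {g i} x)" for x
    by (subst suminf_finite[OF fin[of x]]) (auto simp: indicator_def)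
  have "(\<integral>\<^sup>+x. of_nat (card {i. g i = x}) * h x \<partial>count_space S)
      = (\<integral>\<^sup>+x. (\<Sum>i. h x * indicator S x * indicator {g i} x) \<partial>count_space UNIV)"
  proof (subst nn_integral_count_space_indicator, simp, intro nn_integral_cong)
    fix x
    have "of_nat (card {i. g i = x}) * h x * indicator S x = (h x * indicator S x) * (\<Sum>i. indicator {g i} x)"
      unfolding card by (rule mult.assoc[THEN trans, OF mult.commute])
    then show "of_nat (card {i. g i = x}) * h x * indicator S x = (\<Sum>i. h x * indicator S x * indicator {g i} x)"
      by (simp only: ennreal_suminf_cmult)
  qed
  also have "\<dots> = (\<Sum>i. \<integral>\<^sup>+x. h x * indicator S x * indicator {g i} x \<partial>count_space UNIV)"
    by (rule nn_integral_suminf) auto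
  also have "\<dots> = (\<Sum>i. h (g i) * indicator S (g i))"
    by (subst nn_integral_indicator_singleton) auto
  finally show ?thesis .
qed

lemma finite_fibers_summable:
  fixes g :: "nat \<Rightarrow> real"
  assumes "summable g" "\<And>i. 0 < g i"
  shows "finite {i. g i = x}"
proof (cases "0 < x")
  case True
  have "eventually (\<lambda>i. g i < x) sequentially"
    using summable_LIMSEQ_zero[OF assms(1)] True by (rule order_tendstoD)
  then obtain n where "\<And>i. n \<le> i \<Longrightarrow> g i < x" by (auto simp: eventually_sequentially)
  then have "i < n" if "g i = x" for i using that by (metis not_le less_irrefl)
  then have "{i. g i = x} \<subseteq> {..<n}" by auto
  then show ?thesis by (rule finite_subset) simp
next
  case False
  then have "{i. g i = x} = {}" using assms(2) by (metis (mono_tags, lifting) empty_Collect_eq)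
  then show ?thesis by simp
qed

text \<open>The sequence \<open>stick_breaking 1\<close> without the powers; both agree on sequences
  in \<open>(0,1)\<close>, and this form is polynomial in the coordinates.\<close>

definition stick :: "(nat \<Rightarrow> real) \<Rightarrow> nat \<Rightarrow> real" where
  "stick u i = (\<Prod>j<i. u j) * (1 - u i)"

text \<open>The sum telescopes: the mass left after \<open>n\<close> sticks is the product of the
  first \<open>n\<close> factors.\<close>

lemma sum_stick: "(\<Sum>i<n. stick u i) = 1 - (\<Prod>i<n. u i)"
  by (induction n) (auto simp: stick_def algebra_simps)

lemma stick_cong: "(\<And>j. j \<le> i \<Longrightarrow> u j = v j) \<Longrightarrow> stick u i = stick v i"
  by (simp add: stick_def)

lemma stick_upd_less [simp]: "i < k \<Longrightarrow> stick (x(k := y)) i = stick x i"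
  by (rule stick_cong) auto

lemma stick_upd_same [simp]: "stick (x(k := y)) k = (\<Prod>j<k. x j) * (1 - y)"
  by (simp add: stick_def)

lemma stick_restrict [simp]: "i < k \<Longrightarrow> stick (restrict u {..<k}) i = stick u i"
  by (rule stick_cong) auto

section \<open>The product space of uniform variables\<close>

abbreviation uniform01 :: "real measure" where
  "uniform01 \<equiv> restrict_space lborel {0<..<1}"

lemma emeasure_uniform01: "S \<in> sets borel \<Longrightarrow> S \<subseteq> {0<..<1} \<Longrightarrow> emeasure uniform01 S = emeasure lborel S"
  by (subst emeasure_restrict_space) auto

lemma id_uniform01 [measurable]: "(\<lambda>x. x) \<in> borel_measurable uniform01"
  by (rule measurable_restrict_space1) simp

lemma prob_space_uniform01: "prob_space uniform01"
  by (rule prob_spaceI) (simp add: space_restrict_space emeasure_uniform01)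

interpretation unif: product_prob_space "\<lambda>_::nat. uniform01" UNIV
  unfolding product_prob_space_def product_prob_space_axioms_def product_sigma_finite_def
  by (auto intro: prob_space_uniform01 prob_space_imp_sigma_finite)

lemma prob_space_uniform01_seq: "prob_space uniform01_seq"
  unfolding uniform01_seq_def by (rule unif.P.prob_space_axioms)

lemma space_uniform01_seq: "space uniform01_seq = {u. \<forall>i. 0 < u i \<and> u i < 1}"
  by (auto simp: uniform01_seq_def space_PiM space_restrict_space PiE_iff)

lemma space_PiM_uniform01: "x \<in> space (PiM I (\<lambda>_. uniform01)) \<Longrightarrow> i \<in> I \<Longrightarrow> 0 < x i \<and> x i < 1"
  by (auto simp: space_PiM space_restrict_space PiE_iff)

lemma component_measurable:
  "i \<in> I \<Longrightarrow> (\<lambda>x. x i) \<in> borel_measurable (PiM I (\<lambda>_. uniform01))"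
  using measurable_compose[OF measurable_component_singleton[of i I "\<lambda>_. uniform01"] id_uniform01] .

lemma stick_measurable [measurable]:
  fixes i k :: nat
  assumes "i < k"
  shows "(\<lambda>x. stick x i) \<in> borel_measurable (PiM {..<k} (\<lambda>_. uniform01))"
proof -
  have "(\<lambda>x. x j) \<in> borel_measurable (PiM {..<k} (\<lambda>_. uniform01))" if "j \<le> i" for j
    using that assms by (intro component_measurable) auto
  then show ?thesis unfolding stick_def
    by (intro borel_measurable_times borel_measurable_prod borel_measurable_diff) auto
qed

lemma stick_box_measurable:
  "(\<And>i. i < k \<Longrightarrow> S i \<in> sets borel) \<Longrightarrow>
    (\<lambda>x. \<Prod>i<k. indicator (S i) (stick x i) :: ennreal) \<in> borel_measurable (PiM {..<k} (\<lambda>_. uniform01))"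
  by (intro borel_measurable_prod_ennreal) (rule measurable_compose[OF stick_measurable borel_measurable_indicator]; simp)

lemma stick_measurable_seq [measurable]: "(\<lambda>x. stick x i) \<in> borel_measurable uniform01_seq"
  unfolding stick_def uniform01_seq_def
  by (intro borel_measurable_times borel_measurable_prod borel_measurable_diff component_measurable) auto

lemma prod_measurable_seq [measurable]: "(\<lambda>x. \<Prod>i<k. x i) \<in> borel_measurable uniform01_seq"
  unfolding uniform01_seq_def by (intro borel_measurable_prod component_measurable) auto

text \<open>The marginal of the infinite product on the first \<open>k\<close> coordinates is the
  finite product, which makes iterated integration available.\<close>

lemma nn_integral_uniform01_seq_restrict:
  assumes [measurable]: "f \<in> borel_measurable (PiM {..<k} (\<lambda>_. uniform01))"
  shows "(\<integral>\<^sup>+u. f (restrict u {..<k}) \<partial>uniform01_seq) = (\<integral>\<^sup>+x. f x \<partial>PiM {..<k} (\<lambda>_. uniform01))"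
  unfolding uniform01_seq_def
proof -
  have [measurable]: "(\<lambda>u. restrict u {..<k}) \<in> measurable (PiM UNIV (\<lambda>_. uniform01)) (PiM {..<k} (\<lambda>_. uniform01))"
    by (rule measurable_restrict_subset) simp
  have "(\<integral>\<^sup>+x. f x \<partial>distr (PiM UNIV (\<lambda>_. uniform01)) (PiM {..<k} (\<lambda>_. uniform01)) (\<lambda>u. restrict u {..<k}))
      = (\<integral>\<^sup>+u. f (restrict u {..<k}) \<partial>PiM UNIV (\<lambda>_. uniform01))"
    by (rule nn_integral_distr) (simp_all add: assms)
  then show "(\<integral>\<^sup>+u. f (restrict u {..<k}) \<partial>PiM UNIV (\<lambda>_. uniform01)) = (\<integral>\<^sup>+x. f x \<partial>PiM {..<k} (\<lambda>_. uniform01))"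
    by (simp only: unif.distr_PiM_restrict_finite[of "{..<k}", OF finite_lessThan subset_UNIV])
qed

lemma nn_integral_PiM_Suc:
  assumes "f \<in> borel_measurable (PiM {..<Suc k} (\<lambda>_. uniform01))"
  shows "(\<integral>\<^sup>+x. f x \<partial>PiM {..<Suc k} (\<lambda>_. uniform01)) =
    (\<integral>\<^sup>+x. (\<integral>\<^sup>+y. f (x(k := y)) \<partial>uniform01) \<partial>PiM {..<k} (\<lambda>_. uniform01))"
  using assms unfolding lessThan_Suc by (intro unif.product_nn_integral_insert) auto

lemma stick_breaking_eq_stick:
  "u \<in> space uniform01_seq \<Longrightarrow> stick_breaking 1 u i = stick u i"
  by (simp add: stick_breaking_def stick_def space_uniform01_seq less_imp_le)

lemma stick_bounds:
  assumes "\<And>j. j \<le> i \<Longrightarrow> 0 < u j \<and> u j < 1"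
  shows "0 < stick u i" "stick u i < 1"
proof -
  have p: "0 < (\<Prod>j<i. u j)" "(\<Prod>j<i. u j) \<le> 1"
    using assms by (auto intro!: prod_pos prod_le_1 simp: less_imp_le)
  show "0 < stick u i" using p assms[of i] by (simp add: stick_def)
  have "(\<Prod>j<i. u j) * (1 - u i) \<le> 1 * (1 - u i)" using p assms[of i] by (intro mult_right_mono) auto
  also have "\<dots> < 1" using assms[of i] by simp
  finally show "stick u i < 1" by (simp add: stick_def)
qed

lemma summable_stick:
  assumes "u \<in> space uniform01_seq"
  shows "summable (stick u)" "(\<Sum>i. stick u i) \<le> 1"
proof -
  have u: "\<And>i. 0 < u i \<and> u i < 1" using assms by (simp add: space_uniform01_seq)
  have "(\<Prod>i<n. u i) \<ge> 0" for n by (intro prod_nonneg) (use u in \<open>auto intro: less_imp_le\<close>)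
  then have *: "(\<Sum>i<n. stick u i) \<le> 1" for n by (simp add: sum_stick)
  show "summable (stick u)"
    by (rule summableI_nonneg_bounded[OF _ *]) (use u in \<open>auto intro!: less_imp_le stick_bounds\<close>)
  then show "(\<Sum>i. stick u i) \<le> 1" by (rule suminf_le_const) (rule *)
qed

section \<open>The multiset of sticks and its law\<close>

text \<open>Stated with \<open>stick_breaking\<close> so that it folds literally into the definition
  of \<open>poisson_dirichlet 1\<close>.\<close>

definition stick_multiset :: "(nat \<Rightarrow> real) \<Rightarrow> real \<Rightarrow> nat" where
  "stick_multiset u x = card {i. stick_breaking 1 u i = x}"

lemma stick_multiset_eq:
  "u \<in> space uniform01_seq \<Longrightarrow> stick_multiset u = (\<lambda>x. card {i. stick u i = x})"
  by (simp add: stick_multiset_def stick_breaking_eq_stick fun_eq_iff)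

lemma
  assumes u: "u \<in> space uniform01_seq"
  shows mcard_stick_multiset: "mcard (stick_multiset u) S = (\<Sum>i. indicator S (stick u i))"
    and msum_stick_multiset: "msum (stick_multiset u) \<le> 1"
    and multisubset_stick_multiset: "multisubset (stick_multiset u)"
proof -
  have b: "0 < stick u i" "stick u i < 1" for i
    using u by (auto intro!: stick_bounds simp: space_uniform01_seq)
  note fin = finite_fibers_summable[of "stick u", OF summable_stick(1)[OF u] b(1)]
  show "mcard (stick_multiset u) S = (\<Sum>i. indicator S (stick u i))"
    using nn_integral_card_fibers[of "stick u" S "\<lambda>_. 1", OF fin]
    by (simp add: mcard_def stick_multiset_eq[OF u])
  have "msum (stick_multiset u) = (\<Sum>i. ennreal (stick u i))"
    using nn_integral_card_fibers[of "stick u" "{0<..1}" ennreal, OF fin] b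
    by (simp add: msum_def stick_multiset_eq[OF u] less_imp_le)
  also have "\<dots> = ennreal (\<Sum>i. stick u i)"
    by (rule suminf_ennreal2) (auto intro: less_imp_le b summable_stick(1)[OF u])
  also have "\<dots> \<le> 1" using summable_stick(2)[OF u] by simp
  finally show "msum (stick_multiset u) \<le> 1" .
  have "{x. stick_multiset u x \<noteq> 0} = range (stick u)"
    using fin by (auto simp: stick_multiset_eq[OF u] card_eq_0_iff)
  then show "multisubset (stick_multiset u)"
    using b by (auto simp: multisubset_def less_imp_le)
qed

lemma random_multisubset_stick_multiset: "random_multisubset uniform01_seq stick_multiset"
  unfolding random_multisubset_def
proof (intro conjI ballI impI)
  fix S :: "real set" assume [measurable]: "S \<in> sets borel"
  have "(\<lambda>u. \<Sum>i. indicator S (stick u i) :: ennreal) \<in> borel_measurable uniform01_seq"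
    by measurable
  then show "(\<lambda>\<omega>. mcard (stick_multiset \<omega>) S) \<in> borel_measurable uniform01_seq"
    by (subst measurable_cong[OF mcard_stick_multiset])
qed (auto simp: multisubset_stick_multiset prob_space_uniform01_seq)

lemma mcard_stick_multiset_nonzero:
  assumes "u \<in> space uniform01_seq" "stick u i \<in> S"
  shows "mcard (stick_multiset u) S \<noteq> 0"
proof -
  have "(\<Sum>i\<in>{i}. indicator S (stick u i)) \<le> (\<Sum>i. indicator S (stick u i) :: ennreal)"
    by (intro sum_le_suminf) auto
  then show ?thesis using assms by (auto simp: mcard_stick_multiset)
qed

text \<open>Given the earlier sticks, stick \<open>k\<close> is uniform on \<open>(0,R)\<close> with
  \<open>R\<close> the mass left, so it hits an interval of length
  \<open>\<beta> k - \<alpha> k\<close> with probability at most that length over \<open>R\<close>.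
  If the earlier sticks lie in their intervals, \<open>R\<close> is at least 1 minus the sum of
  their right ends. Integrating out the last coordinate gives the induction.\<close>

lemma nn_integral_stick_box_le:
  assumes "\<And>i. i < k \<Longrightarrow> \<alpha> i \<le> \<beta> i" "\<And>i. i < k \<Longrightarrow> (\<Sum>l<i. \<beta> l) < (1::real)"
  shows "(\<integral>\<^sup>+x. (\<Prod>i<k. indicator {\<alpha> i<..\<beta> i} (stick x i)) \<partial>PiM {..<k} (\<lambda>_. uniform01))
    \<le> ennreal (\<Prod>i<k. (\<beta> i - \<alpha> i) / (1 - (\<Sum>l<i. \<beta> l)))"
  using assms
proof (induction k)
  case 0
  then show ?case by (simp add: space_PiM)
next
  case (Suc k)
  let ?P = "\<lambda>k. PiM {..<k} (\<lambda>_. uniform01)"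
  let ?I = "\<lambda>k x. \<Prod>i<k. indicator {\<alpha> i<..\<beta> i} (stick x i) :: ennreal"
  let ?r = "1 - (\<Sum>l<k. \<beta> l)"
  have r: "0 < ?r" using Suc.prems(2)[of k] by simp
  have [measurable]: "?I k' \<in> borel_measurable (?P k')" for k'
    by (rule stick_box_measurable) simp
  have step: "(\<integral>\<^sup>+y. ?I (Suc k) (x(k := y)) \<partial>uniform01) \<le> ?I k x * ennreal ((\<beta> k - \<alpha> k) / ?r)"
    if x: "x \<in> space (?P k)" for x
  proof (cases "\<forall>i<k. stick x i \<in> {\<alpha> i<..\<beta> i}")
    case True
    let ?R = "\<Prod>j<k. x j"
    have "(\<Sum>i<k. stick x i) \<le> (\<Sum>l<k. \<beta> l)" using True by (intro sum_mono) auto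
    then have R: "?r \<le> ?R" by (simp add: sum_stick)
    then have R0: "0 < ?R" using r by linarith
    have "(\<integral>\<^sup>+y. ?I (Suc k) (x(k := y)) \<partial>uniform01) = (\<integral>\<^sup>+y. indicator {\<alpha> k<..\<beta> k} (?R * (1 - y)) \<partial>uniform01)"
      using True by (intro nn_integral_cong) simp
    also have "\<dots> = (\<integral>\<^sup>+y. indicator {\<alpha> k<..\<beta> k} (?R * (1 - y)) * indicator {0<..<1} y \<partial>lborel)"
      by (subst nn_integral_restrict_space) auto
    also have "\<dots> \<le> (\<integral>\<^sup>+y. indicator {1 - \<beta> k / ?R..1 - \<alpha> k / ?R} y \<partial>lborel)"
    proof (intro nn_integral_mono)
      fix y
      have "\<alpha> k < ?R * (1 - y) \<longleftrightarrow> \<alpha> k / ?R < 1 - y" "?R * (1 - y) \<le> \<beta> k \<longleftrightarrow> 1 - y \<le> \<beta> k / ?R"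
        using R0 by (simp_all add: pos_divide_less_eq pos_le_divide_eq mult.commute)
      then show "indicator {\<alpha> k<..\<beta> k} (?R * (1 - y)) * indicator {0<..<1} y
          \<le> (indicator {1 - \<beta> k / ?R..1 - \<alpha> k / ?R} y :: ennreal)"
        by (auto simp: indicator_def)
    qed
    also have "\<dots> = ennreal ((\<beta> k - \<alpha> k) / ?R)"
      using R0 Suc.prems(1)[of k] by (simp add: divide_right_mono diff_divide_distrib)
    also have "\<dots> \<le> ennreal ((\<beta> k - \<alpha> k) / ?r)"
      using R r Suc.prems(1)[of k] by (intro ennreal_leI divide_left_mono) auto
    finally show ?thesis using True by simp
  next
    case False
    then obtain i where i: "i < k" "stick x i \<notin> {\<alpha> i<..\<beta> i}" by blast
    then have z: "?I (Suc k) (x(k := y)) = 0" for y by (intro prod_zero) (auto intro!: bexI[of _ i])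
    show ?thesis by (simp only: z nn_integral_const mult_zero_left zero_le)
  qed
  have "(\<integral>\<^sup>+x. ?I (Suc k) x \<partial>?P (Suc k)) = (\<integral>\<^sup>+x. (\<integral>\<^sup>+y. ?I (Suc k) (x(k := y)) \<partial>uniform01) \<partial>?P k)"
    by (rule nn_integral_PiM_Suc) measurable
  also have "\<dots> \<le> (\<integral>\<^sup>+x. ?I k x * ennreal ((\<beta> k - \<alpha> k) / ?r) \<partial>?P k)"
    by (intro nn_integral_mono step)
  also have "\<dots> = (\<integral>\<^sup>+x. ?I k x \<partial>?P k) * ennreal ((\<beta> k - \<alpha> k) / ?r)"
    by (rule nn_integral_multc) measurable
  also have "\<dots> \<le> ennreal (\<Prod>i<k. (\<beta> i - \<alpha> i) / (1 - (\<Sum>l<i. \<beta> l))) * ennreal ((\<beta> k - \<alpha> k) / ?r)"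
    using Suc.prems by (intro mult_right_mono Suc.IH) auto
  also have "\<dots> = ennreal (\<Prod>i<Suc k. (\<beta> i - \<alpha> i) / (1 - (\<Sum>l<i. \<beta> l)))"
    using Suc.prems r by (subst ennreal_mult[symmetric])
      (auto intro!: prod_nonneg divide_nonneg_nonneg simp: less_imp_le less_Suc_eq)
  finally show ?case .
qed

lemma emeasure_stick_box_le:
  assumes "\<And>i. i < k \<Longrightarrow> \<alpha> i \<le> \<beta> i" "\<And>i. i < k \<Longrightarrow> (\<Sum>l<i. \<beta> l) < (1::real)"
  shows "emeasure uniform01_seq {u\<in>space uniform01_seq. \<forall>i<k. stick u i \<in> {\<alpha> i<..\<beta> i}}
    \<le> ennreal (\<Prod>i<k. (\<beta> i - \<alpha> i) / (1 - (\<Sum>l<i. \<beta> l)))"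
proof -
  let ?I = "\<lambda>x. \<Prod>i<k. indicator {\<alpha> i<..\<beta> i} (stick x i) :: ennreal"
  have [measurable]: "?I \<in> borel_measurable (PiM {..<k} (\<lambda>_. uniform01))"
    by (rule stick_box_measurable) simp
  have "emeasure uniform01_seq {u\<in>space uniform01_seq. \<forall>i<k. stick u i \<in> {\<alpha> i<..\<beta> i}}
     = (\<integral>\<^sup>+u. indicator {u\<in>space uniform01_seq. \<forall>i<k. stick u i \<in> {\<alpha> i<..\<beta> i}} u \<partial>uniform01_seq)"
    by simp
  also have "\<dots> = (\<integral>\<^sup>+u. ?I (restrict u {..<k}) \<partial>uniform01_seq)"
  proof (intro nn_integral_cong)
    fix u assume u: "u \<in> space uniform01_seq"
    show "indicator {u\<in>space uniform01_seq. \<forall>i<k. stick u i \<in> {\<alpha> i<..\<beta> i}} u = ?I (restrict u {..<k})"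
    proof (cases "\<forall>i<k. stick u i \<in> {\<alpha> i<..\<beta> i}")
      case False
      then show ?thesis by (subst prod_zero[of "{..<k}"]) (auto simp: indicator_def)
    qed (use u in auto)
  qed
  also have "\<dots> = (\<integral>\<^sup>+x. ?I x \<partial>PiM {..<k} (\<lambda>_. uniform01))"
    by (rule nn_integral_uniform01_seq_restrict) measurable
  also have "\<dots> \<le> ennreal (\<Prod>i<k. (\<beta> i - \<alpha> i) / (1 - (\<Sum>l<i. \<beta> l)))"
    by (rule nn_integral_stick_box_le[OF assms])
  finally show ?thesis .
qed

text \<open>With the earlier coordinates fixed, at most one value of coordinate \<open>k\<close>
  makes the two sticks equal.\<close>

lemma AE_stick_neq:
  assumes "i < k"
  shows "AE u in uniform01_seq. stick u i \<noteq> stick u k"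
proof -
  let ?N = "{u\<in>space uniform01_seq. stick u i = stick u k}"
  let ?f = "\<lambda>x. indicator {0::real} (stick x i - stick x k) :: ennreal"
  have meas: "?f \<in> borel_measurable (PiM {..<Suc k} (\<lambda>_. uniform01))"
    using assms
    by (intro measurable_compose[OF borel_measurable_diff borel_measurable_indicator] stick_measurable) auto
  have "emeasure uniform01_seq ?N = (\<integral>\<^sup>+u. indicator ?N u \<partial>uniform01_seq)"
    by simp
  also have "\<dots> = (\<integral>\<^sup>+u. ?f (restrict u {..<Suc k}) \<partial>uniform01_seq)"
    using assms by (intro nn_integral_cong) (auto simp: indicator_def)
  also have "\<dots> = (\<integral>\<^sup>+x. (\<integral>\<^sup>+y. ?f (x(k := y)) \<partial>uniform01) \<partial>PiM {..<k} (\<lambda>_. uniform01))"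
    unfolding nn_integral_uniform01_seq_restrict[OF meas] by (rule nn_integral_PiM_Suc[OF meas])
  also have "\<dots> = (\<integral>\<^sup>+x. 0 \<partial>PiM {..<k} (\<lambda>_. uniform01))"
  proof (intro nn_integral_cong)
    fix x assume x: "x \<in> space (PiM {..<k} (\<lambda>_. uniform01))"
    let ?R = "\<Prod>j<k. x j"
    have R: "0 < ?R" by (intro prod_pos) (use space_PiM_uniform01[OF x] in auto)
    have "(\<integral>\<^sup>+y. ?f (x(k := y)) \<partial>uniform01) = (\<integral>\<^sup>+y. indicator {0} (stick x i - ?R * (1 - y)) * indicator {0<..<1} y \<partial>lborel)"
      using assms by (subst nn_integral_restrict_space) auto
    also have "\<dots> \<le> (\<integral>\<^sup>+y. indicator {1 - stick x i / ?R} y \<partial>lborel)"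
    proof (intro nn_integral_mono)
      fix y
      have "s - r * (1 - y) = 0 \<longleftrightarrow> y = 1 - s / r" if "0 < r" for s r :: real
        using that by (auto simp: field_simps)
      from this[OF R] have "stick x i - ?R * (1 - y) = 0 \<longleftrightarrow> y = 1 - stick x i / ?R" .
      then show "indicator {0} (stick x i - ?R * (1 - y)) * indicator {0<..<1} y
          \<le> (indicator {1 - stick x i / ?R} y :: ennreal)"
        by (auto simp: indicator_def)
    qed
    also have "\<dots> = 0" by simp
    finally show "(\<integral>\<^sup>+y. ?f (x(k := y)) \<partial>uniform01) = 0" by simp
  qed
  finally have "emeasure uniform01_seq ?N = 0" by simp
  then show ?thesis by (intro AE_I[of _ _ ?N]) auto
qed

lemma nn_integral_uniform01_id: "(\<integral>\<^sup>+x. ennreal x \<partial>uniform01) = ennreal (1/2)"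
proof -
  have "(\<integral>\<^sup>+x. ennreal x \<partial>uniform01) = (\<integral>\<^sup>+x. ennreal x * indicator {0<..<1} x \<partial>lborel)"
    by (subst nn_integral_restrict_space) auto
  also have "\<dots> = (\<integral>\<^sup>+x. ennreal x * indicator {0..1} x \<partial>lborel)"
  proof (rule nn_integral_cong_AE)
    have "AE x in lborel. x \<noteq> (0::real) \<and> x \<noteq> 1"
      using AE_lborel_singleton[of "0::real"] AE_lborel_singleton[of "1::real"] by auto
    then show "AE x in lborel. ennreal x * indicator {0<..<1} x = ennreal x * indicator {0..1} x"
      by (rule AE_mp) (auto simp: indicator_def)
  qed
  also have "\<dots> = ennreal (1\<^sup>2/2 - 0\<^sup>2/2)"
    by (rule nn_integral_FTC_Icc) (auto intro!: derivative_eq_intros)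
  finally show ?thesis by simp
qed

text \<open>Markov's inequality: the mass left after \<open>k\<close> sticks is a product of
  independent uniform variables and has mean \<open>(1/2)^k\<close>.\<close>

lemma emeasure_prod_ge_le:
  assumes "0 < d"
  shows "emeasure uniform01_seq {u\<in>space uniform01_seq. d \<le> (\<Prod>i<k. u i)} \<le> ennreal ((1/2)^k / d)"
proof -
  let ?f = "\<lambda>x. \<Prod>i<k. ennreal (x i)"
  have [measurable]: "?f \<in> borel_measurable (PiM {..<k} (\<lambda>_. uniform01))"
    by (intro borel_measurable_prod_ennreal measurable_compose[OF component_measurable measurable_ennreal]) auto
  have "emeasure uniform01_seq {u\<in>space uniform01_seq. d \<le> (\<Prod>i<k. u i)}
      = (\<integral>\<^sup>+u. indicator {u\<in>space uniform01_seq. d \<le> (\<Prod>i<k. u i)} u \<partial>uniform01_seq)"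
    by simp
  also have "\<dots> \<le> (\<integral>\<^sup>+u. ennreal (1/d) * ?f (restrict u {..<k}) \<partial>uniform01_seq)"
  proof (intro nn_integral_mono)
    fix u assume u: "u \<in> space uniform01_seq"
    have "ennreal (1/d) * ?f (restrict u {..<k}) = ennreal (1/d * (\<Prod>i<k. u i))"
      using u assms
      by (subst ennreal_mult') (auto simp: space_uniform01_seq prod_ennreal less_imp_le)
    moreover have "1 \<le> 1/d * (\<Prod>i<k. u i)" if "d \<le> (\<Prod>i<k. u i)"
      using that assms by simp
    ultimately show "indicator {u\<in>space uniform01_seq. d \<le> (\<Prod>i<k. u i)} u \<le> ennreal (1/d) * ?f (restrict u {..<k})"
      by (auto simp: indicator_def)
  qed
  also have "\<dots> = (\<integral>\<^sup>+x. ennreal (1/d) * ?f x \<partial>PiM {..<k} (\<lambda>_. uniform01))"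
    by (rule nn_integral_uniform01_seq_restrict) measurable
  also have "\<dots> = ennreal (1/d) * (\<integral>\<^sup>+x. ?f x \<partial>PiM {..<k} (\<lambda>_. uniform01))"
    by (rule nn_integral_cmult) measurable
  also have "(\<integral>\<^sup>+x. ?f x \<partial>PiM {..<k} (\<lambda>_. uniform01)) = (\<Prod>i<k. ennreal (1/2))"
    by (subst unif.product_nn_integral_prod[of "{..<k}" "\<lambda>_ x. ennreal x"]) (auto simp: nn_integral_uniform01_id)
  also have "(\<Prod>i<k. ennreal (1/2)) = ennreal ((1/2)^k)"
    by (subst ennreal_power[symmetric], simp, simp only: prod_constant card_lessThan)
  also have "ennreal (1/d) * ennreal ((1/2)^k) = ennreal ((1/2)^k / d)"
    by (subst ennreal_mult''[symmetric]) auto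
  finally show ?thesis .
qed

section \<open>Weighted tuple counts\<close>

definition inj_tuples :: "nat \<Rightarrow> nat \<Rightarrow> (nat \<Rightarrow> nat) set" where
  "inj_tuples N k = {j \<in> {..<k} \<rightarrow>\<^sub>E {..<N}. inj_on j {..<k}}"

lemma finite_inj_tuples: "finite (inj_tuples N k)"
  by (rule finite_subset[of _ "{..<k} \<rightarrow>\<^sub>E {..<N}"]) (auto simp: inj_tuples_def intro!: finite_PiE)

text \<open>The weight \<open>w(j)\<close> of the overview. Subtraction is truncated: when the
  earlier indices add up to \<open>N\<close> or more, the factor is a division by 0 and hence
  0.\<close>

definition tuple_weight :: "nat \<Rightarrow> nat \<Rightarrow> (nat \<Rightarrow> nat) \<Rightarrow> real" where
  "tuple_weight N k j = (\<Prod>i<k. real (j i) / real (N - (\<Sum>l<i. j l)))"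

lemma tuple_weight_nonneg: "0 \<le> tuple_weight N k j"
  unfolding tuple_weight_def by (intro prod_nonneg) auto

text \<open>If \<open>c l\<close> counts the elements of size \<open>l\<close>, the summands are lower bounds for the
  probabilities that size-biased sampling without replacement picks sizes \<open>j 0, j 1, \<dots>\<close> in this
  order.\<close>
lemma sum_tuple_weight_le_1:
  assumes "(\<Sum>l<N. l * c l) \<le> N"
  shows "(\<Sum>j\<in>inj_tuples N k. tuple_weight N k j * (\<Prod>i<k. real (c (j i)))) \<le> 1"
proof (induction k)
  case 0
  then show ?case by (simp add: inj_tuples_def tuple_weight_def)
next
  case (Suc k)
  let ?F = "\<lambda>k j. tuple_weight N k j * (\<Prod>i<k. real (c (j i)))"
  \<comment> \<open>A tuple of length \<open>k+1\<close> is a tuple of length \<open>k\<close> with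
    a fresh last index.\<close>
  have bij: "bij_betw (\<lambda>(g, y). g(k := y)) (SIGMA g:inj_tuples N k. {..<N} - g ` {..<k}) (inj_tuples N (Suc k))"
  proof (rule bij_betwI[where g = "\<lambda>j. (restrict j {..<k}, j k)"])
    show "(\<lambda>(g, y). g(k := y)) \<in> (SIGMA g:inj_tuples N k. {..<N} - g ` {..<k}) \<rightarrow> inj_tuples N (Suc k)"
      by (auto simp: inj_tuples_def lessThan_Suc PiE_iff extensional_def inj_on_def)
    show "(\<lambda>j. (restrict j {..<k}, j k)) \<in> inj_tuples N (Suc k) \<rightarrow> (SIGMA g:inj_tuples N k. {..<N} - g ` {..<k})"
    proof
      fix j assume "j \<in> inj_tuples N (Suc k)"
      then have "inj_on j (insert k {..<k})" "\<And>i. i < k \<Longrightarrow> j i < N" "j k < N"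
        by (auto simp: inj_tuples_def lessThan_Suc PiE_iff)
      then show "(restrict j {..<k}, j k) \<in> (SIGMA g:inj_tuples N k. {..<N} - g ` {..<k})"
        by (auto simp: inj_tuples_def PiE_iff inj_on_restrict_eq)
    qed
  next
    fix gy assume "gy \<in> (SIGMA g:inj_tuples N k. {..<N} - g ` {..<k})"
    then obtain g y where gy: "gy = (g, y)" "g \<in> extensional {..<k}"
      by (auto simp: inj_tuples_def PiE_iff)
    have "restrict (g(k := y)) {..<k} = restrict g {..<k}" by (rule restrict_ext) simp
    then show "(\<lambda>j. (restrict j {..<k}, j k)) ((\<lambda>(g, y). g(k := y)) gy) = gy"
      using gy by (simp add: extensional_restrict)
  next
    fix j assume "j \<in> inj_tuples N (Suc k)"
    then have "j \<in> extensional (insert k {..<k})" by (auto simp: inj_tuples_def PiE_iff lessThan_Suc)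
    then show "(\<lambda>(g, y). g(k := y)) (restrict j {..<k}, j k) = j"
      by (auto simp: fun_eq_iff extensional_def)
  qed
  have "(\<Sum>j\<in>inj_tuples N (Suc k). ?F (Suc k) j)
      = (\<Sum>(g, y)\<in>(SIGMA g:inj_tuples N k. {..<N} - g ` {..<k}). ?F (Suc k) (g(k := y)))"
    by (subst sum.reindex_bij_betw[OF bij, symmetric]) (simp add: case_prod_unfold)
  also have "\<dots> = (\<Sum>g\<in>inj_tuples N k. \<Sum>y\<in>{..<N} - g ` {..<k}. ?F (Suc k) (g(k := y)))"
    by (rule sum.Sigma[symmetric]) (auto simp: finite_inj_tuples)
  also have "\<dots> = (\<Sum>g\<in>inj_tuples N k. ?F k g *
      ((\<Sum>y\<in>{..<N} - g ` {..<k}. real (y * c y)) / real (N - (\<Sum>l<k. g l))))"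
    by (simp add: tuple_weight_def sum_distrib_left sum_divide_distrib ac_simps)
  also have "\<dots> \<le> (\<Sum>g\<in>inj_tuples N k. ?F k g * 1)"
  proof (rule sum_mono)
    fix g assume g: "g \<in> inj_tuples N k"
    \<comment> \<open>If all cells of \<open>g\<close> are occupied, they use up at least
      \<open>\<Sum>l<k. g l\<close> of the budget \<open>N\<close>, so the other cells share at most
      the denominator. If one is empty, both sides vanish.\<close>
    show "?F k g * ((\<Sum>y\<in>{..<N} - g ` {..<k}. real (y * c y)) / real (N - (\<Sum>l<k. g l))) \<le> ?F k g * 1"
    proof (cases "\<forall>i<k. 1 \<le> c (g i)")
      case True
      have g': "g ` {..<k} \<subseteq> {..<N}" "inj_on g {..<k}" using g by (auto simp: inj_tuples_def)
      have "(\<Sum>l<k. g l) \<le> (\<Sum>l<k. g l * c (g l))" using True by (intro sum_mono) auto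
      also have "\<dots> = (\<Sum>y\<in>g ` {..<k}. y * c y)" by (simp add: sum.reindex[OF g'(2)])
      finally have "(\<Sum>y\<in>{..<N} - g ` {..<k}. y * c y) \<le> N - (\<Sum>l<k. g l)"
        using assms by (simp add: sum.subset_diff[OF g'(1)])
      then have "real (\<Sum>y\<in>{..<N} - g ` {..<k}. y * c y) \<le> real (N - (\<Sum>l<k. g l))"
        by (rule of_nat_mono)
      then have "(\<Sum>y\<in>{..<N} - g ` {..<k}. real (y * c y)) / real (N - (\<Sum>l<k. g l)) \<le> 1"
        by (auto simp: divide_le_eq_1)
      then show ?thesis
        by (intro mult_left_mono) (auto intro!: mult_nonneg_nonneg prod_nonneg tuple_weight_nonneg)
    next
      case False
      then have "(\<Prod>i<k. real (c (g i))) = 0" by (auto simp: not_le)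
      then show ?thesis by (simp only: mult_zero_left mult_zero_right order_refl)
    qed
  qed
  finally show ?case using Suc.IH by simp
qed

section \<open>The grid of mesh \<open>1/N\<close>\<close>

text \<open>Half-open, so that the cells with \<open>l < N\<close> partition
  \<open>(0,1]\<close>.\<close>

definition cell :: "nat \<Rightarrow> nat \<Rightarrow> real set" where
  "cell N l = {real l / real N<..real (Suc l) / real N}"

lemma disjoint_cells: "0 < N \<Longrightarrow> l \<noteq> l' \<Longrightarrow> cell N l \<inter> cell N l' = {}"
proof (induction l l' rule: linorder_wlog)
  case (le l l')
  then have "real (Suc l) / real N \<le> real l' / real N" by (intro divide_right_mono) auto
  then show ?case by (auto simp: cell_def)
qed auto

lemma cell_exists:
  assumes "0 < N" "0 < x" "x < 1"
  shows "\<exists>l<N. x \<in> cell N l"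
proof -
  \<comment> \<open>Rounding up and subtracting 1 matches cells that are closed on the
    right.\<close>
  let ?l = "nat (\<lceil>N * x\<rceil> - 1)"
  have "0 < \<lceil>N * x\<rceil>" using assms by simp
  then have l: "real ?l = of_int \<lceil>N * x\<rceil> - 1" by (simp add: of_nat_nat)
  have "real ?l < N * x" "N * x \<le> real (Suc ?l)" unfolding of_nat_Suc l by linarith+
  then have "x \<in> cell N ?l" using assms by (simp add: cell_def field_simps)
  moreover have "real ?l < real N"
    using \<open>real ?l < N * x\<close> assms by (smt (verit) mult_left_le of_nat_0_le_iff)
  ultimately show ?thesis by (intro exI[of _ ?l]) simp
qed

text \<open>Elements of cell \<open>l\<close> are at least \<open>l/N\<close>, so mass at most 1
  gives the cell counts \<open>\<Sum>l<N. l * c l \<le> N\<close>, and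
  \<open>sum_tuple_weight_le_1\<close> applies. In the application \<open>h\<close> is the value of
  a test function at \<open>m\<close>, and \<open>v j\<close> bounds it from below whenever
  \<open>m\<close> meets all cells of \<open>j\<close>.\<close>

lemma sum_tuple_mcard_le:
  assumes ms: "msum m \<le> 1" and N: "0 < N" and T: "T \<subseteq> inj_tuples N k"
    and pos: "\<And>j i. j \<in> T \<Longrightarrow> i < k \<Longrightarrow> 0 < j i"
    and v: "\<And>j. j \<in> T \<Longrightarrow> 0 \<le> v j" "0 \<le> h"
      "\<And>j. j \<in> T \<Longrightarrow> (\<And>i. i < k \<Longrightarrow> mcard m (cell N (j i)) \<noteq> 0) \<Longrightarrow> v j \<le> h"
  shows "(\<Sum>j\<in>T. ennreal (v j * tuple_weight N k j) * (\<Prod>i<k. mcard m (cell N (j i)))) \<le> ennreal h"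
proof -
  have ft: "finite_tails m" using ms by (auto intro!: finite_tails_if_msum_finite elim: order.strict_trans1)
  have cell_sub: "cell N l \<subseteq> {0<..1}" if "l < N" for l
  proof -
    have "0 \<le> real l / real N" "real (Suc l) / real N \<le> 1" using that N by auto
    then show ?thesis unfolding cell_def subset_iff greaterThanAtMost_iff by (intro allI impI) linarith
  qed
  have "\<exists>c::nat. mcard m (cell N l) = of_nat c" if "0 < l" "l < N" for l
  proof -
    have "cell N l \<subseteq> {real l / real N..1}" using cell_sub[OF that(2)] by (auto simp: cell_def)
    then have "mcard m (cell N l) < \<infinity>" using that N by (intro finite_tails_mcard[OF ft]) auto
    then show ?thesis by (metis mcard_nat)
  qed
  \<comment> \<open>Cell 0 is left out, as it may contain infinitely many elements.\<close>
  then obtain c :: "nat \<Rightarrow> nat" where c: "\<And>l. 0 < l \<Longrightarrow> l < N \<Longrightarrow> mcard m (cell N l) = of_nat (c l)"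
    by metis
  have "(\<Sum>l\<in>{0<..<N}. ennreal (real l / real N) * mcard m (cell N l)) \<le> msum m"
  proof (rule sum_mcard_le_msum)
    fix u :: real
    show "(\<Sum>l\<in>{0<..<N}. ennreal (real l / real N) * indicator (cell N l) u) \<le> ennreal u"
    proof (cases "\<exists>l\<in>{0<..<N}. u \<in> cell N l")
      case True
      then obtain l where l: "l \<in> {0<..<N}" "u \<in> cell N l" by blast
      then have "indicator (cell N l') u = (if l' = l then 1 else 0 :: ennreal)" for l'
        using disjoint_cells[OF N, of l l'] by (auto simp: indicator_def)
      then have "(\<Sum>l'\<in>{0<..<N}. ennreal (real l' / real N) * indicator (cell N l') u) = ennreal (real l / real N)"
        using l by (simp add: if_distrib[of "\<lambda>x. _ * x"] cong: if_cong)
      also have "\<dots> \<le> ennreal u" using l by (auto simp: cell_def intro: ennreal_leI)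
      finally show ?thesis .
    qed simp
  qed (use cell_sub in auto)
  also have "(\<Sum>l\<in>{0<..<N}. ennreal (real l / real N) * mcard m (cell N l))
      = (\<Sum>l\<in>{0<..<N}. ennreal (real l * real (c l) / real N))"
    by (intro sum.cong refl) (simp add: c ennreal_of_nat_eq_real_of_nat ennreal_mult'[symmetric])
  also have "\<dots> = ennreal (real (\<Sum>l\<in>{0<..<N}. l * c l) / real N)"
    by (simp add: sum_divide_distrib)
  finally have "ennreal (real (\<Sum>l\<in>{0<..<N}. l * c l) / real N) \<le> 1" using ms by (rule order_trans)
  then have "real (\<Sum>l\<in>{0<..<N}. l * c l) \<le> real N" using N by (simp add: divide_le_eq)
  then have "(\<Sum>l\<in>{0<..<N}. l * c l) \<le> N" by (simp only: of_nat_le_iff)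
  also have "(\<Sum>l\<in>{0<..<N}. l * c l) = (\<Sum>l<N. l * c l)"
    by (rule sum.mono_neutral_left) auto
  finally have cN: "(\<Sum>l<N. l * c l) \<le> N" .
  let ?t = "\<lambda>j. tuple_weight N k j * (\<Prod>i<k. real (c (j i)))"
  have t0: "0 \<le> ?t j" for j by (intro mult_nonneg_nonneg tuple_weight_nonneg prod_nonneg) auto
  have finT: "finite T" using T finite_inj_tuples by (rule finite_subset)
  have "(\<Sum>j\<in>T. ennreal (v j * tuple_weight N k j) * (\<Prod>i<k. mcard m (cell N (j i))))
      \<le> (\<Sum>j\<in>T. ennreal (h * ?t j))"
  proof (rule sum_mono)
    fix j assume j: "j \<in> T"
    then have jN: "\<And>i. i < k \<Longrightarrow> j i < N" using T by (auto simp: inj_tuples_def)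
    have prod: "(\<Prod>i<k. mcard m (cell N (j i))) = ennreal (\<Prod>i<k. real (c (j i)))"
      using c pos[OF j] jN by (simp add: ennreal_of_nat_eq_real_of_nat prod_ennreal)
    have "ennreal (v j * tuple_weight N k j) * (\<Prod>i<k. mcard m (cell N (j i))) = ennreal (v j * ?t j)"
      unfolding prod using v(1)[OF j]
      by (subst ennreal_mult'[symmetric]) (auto intro!: mult_nonneg_nonneg tuple_weight_nonneg simp: ac_simps)
    also have "\<dots> \<le> ennreal (h * ?t j)"
    \<comment> \<open>A tuple with an empty cell contributes 0; for the others \<open>v j\<close> is
      at most \<open>h\<close>.\<close>
    proof (cases "\<forall>i<k. mcard m (cell N (j i)) \<noteq> 0")
      case True
      then show ?thesis using v(3)[OF j] t0[of j] by (intro ennreal_leI mult_right_mono) auto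
    next
      case False
      then obtain i where "i < k" "c (j i) = 0" using c pos[OF j] jN by fastforce
      then have "?t j = 0" by auto
      then show ?thesis by (simp only: mult_zero_right order_refl)
    qed
    finally show "ennreal (v j * tuple_weight N k j) * (\<Prod>i<k. mcard m (cell N (j i))) \<le> ennreal (h * ?t j)" .
  qed
  also have "\<dots> = ennreal (h * (\<Sum>j\<in>T. ?t j))"
    using v(2) t0 by (subst sum_ennreal) (auto simp: sum_distrib_left intro: mult_nonneg_nonneg)
  also have "\<dots> \<le> ennreal (h * 1)"
  proof (intro ennreal_leI mult_left_mono)
    have "(\<Sum>j\<in>T. ?t j) \<le> (\<Sum>j\<in>inj_tuples N k. ?t j)"
      using t0 by (intro sum_mono2 finite_inj_tuples T) auto
    also have "\<dots> \<le> 1" by (rule sum_tuple_weight_le_1[OF cN])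
    finally show "(\<Sum>j\<in>T. ?t j) \<le> 1" .
  qed (rule v(2))
  finally show ?thesis by simp
qed

text \<open>Half-open cells are approximated from inside by the closed intervals of the hypothesis.\<close>
lemma eventually_cell_intensity:
  fixes A :: "nat \<Rightarrow> 'a \<Rightarrow> real \<Rightarrow> nat"
  assumes hyp: "\<And>a b. admissible_intervals k a b \<Longrightarrow>
      ennreal (\<Prod>i<k. (b i - a i) / b i) \<le> liminf (\<lambda>n. \<integral>\<^sup>+\<omega>. (\<Prod>i<k. mcard (A n \<omega>) {a i..b i}) \<partial>M n)"
    and k: "1 \<le> k" and N: "0 < N" and e: "0 < e" "e < 1"
    and j: "inj_on j {..<k}" "(\<Sum>i<k. Suc (j i)) < N"
  shows "eventually (\<lambda>n. ennreal ((1 - e) * (\<Prod>i<k. 1 / real (Suc (j i))))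
    \<le> (\<integral>\<^sup>+\<omega>. (\<Prod>i<k. mcard (A n \<omega>) (cell N (j i))) \<partial>M n)) sequentially"
proof -
  \<comment> \<open>Cutting the fraction \<open>\<tau>\<close> off the left of each cell leaves the
    factor \<open>(1 - \<tau>)^k\<close>, which by Bernoulli is at least
    \<open>1 - e/2\<close>.\<close>
  define \<tau> where "\<tau> = e / (2 * real k)"
  have \<tau>: "0 < \<tau>" "\<tau> < 1" "real k * \<tau> = e / 2" using e k by (auto simp: \<tau>_def field_simps)
  define a where "a i = (real (j i) + \<tau>) / real N" for i
  define b where "b i = real (Suc (j i)) / real N" for i
  have sub: "{a i..b i} \<subseteq> cell N (j i)" for i
    using \<tau> N by (auto simp: a_def b_def cell_def field_simps)
  have "(\<Sum>i<k. b i) = real (\<Sum>i<k. Suc (j i)) / real N" by (simp add: b_def sum_divide_distrib)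
  also have "\<dots> < 1" using j(2) N by (simp only: divide_less_eq_1_pos of_nat_0_less_iff of_nat_less_iff)
  finally have sumb: "(\<Sum>i<k. b i) < 1" .
  have adm: "admissible_intervals k a b"
    unfolding admissible_intervals_def
  proof (intro conjI allI impI)
    fix i assume "i < k"
    show "a i \<le> b i" using \<tau> N by (auto simp: a_def b_def intro!: divide_right_mono)
    have "b i \<le> (\<Sum>i<k. b i)" using \<open>i < k\<close> by (intro member_le_sum) (auto simp: b_def)
    moreover have "0 < a i" using \<tau> N by (auto simp: a_def intro!: divide_pos_pos add_nonneg_pos)
    ultimately show "{a i..b i} \<subseteq> {0<..1}" using sumb by auto
  next
    show "disjoint_family_on (\<lambda>i. {a i..b i}) {..<k}"
      unfolding disjoint_family_on_def
    proof (intro ballI impI)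
      fix i l assume "i \<in> {..<k}" "l \<in> {..<k}" "i \<noteq> l"
      then have "cell N (j i) \<inter> cell N (j l) = {}" using j(1) by (intro disjoint_cells N) (auto simp: inj_on_def)
      then show "{a i..b i} \<inter> {a l..b l} = {}" using sub[of i] sub[of l] by blast
    qed
  qed (rule sumb)
  have "(b i - a i) / b i = (1 - \<tau>) * (1 / real (Suc (j i)))" for i
    using N by (simp add: a_def b_def diff_divide_distrib[symmetric])
  then have prod: "(\<Prod>i<k. (b i - a i) / b i) = (1 - \<tau>) ^ k * (\<Prod>i<k. 1 / real (Suc (j i)))"
    by (simp only: prod.distrib prod_constant card_lessThan)
  have "1 - e < 1 + real k * (- \<tau>)" using \<tau>(3) e by simp
  also have "\<dots> \<le> (1 + (- \<tau>)) ^ k" using \<tau> by (intro Bernoulli_inequality) simp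
  finally have lt: "1 - e < (1 - \<tau>) ^ k" by simp
  have "0 < (\<Prod>i<k. 1 / real (Suc (j i)))" by (intro prod_pos) simp
  \<comment> \<open>The inequality is made strict, because only values strictly below the liminf are
    eventually exceeded.\<close>
  then have "ennreal ((1 - e) * (\<Prod>i<k. 1 / real (Suc (j i)))) < ennreal (\<Prod>i<k. (b i - a i) / b i)"
    unfolding prod using lt e by (intro ennreal_lessI mult_strict_right_mono mult_pos_pos zero_less_power) (use \<tau> in auto)
  also have "\<dots> \<le> liminf (\<lambda>n. \<integral>\<^sup>+\<omega>. (\<Prod>i<k. mcard (A n \<omega>) {a i..b i}) \<partial>M n)" by (rule hyp[OF adm])
  finally have "eventually (\<lambda>n. ennreal ((1 - e) * (\<Prod>i<k. 1 / real (Suc (j i))))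
      < (\<integral>\<^sup>+\<omega>. (\<Prod>i<k. mcard (A n \<omega>) {a i..b i}) \<partial>M n)) sequentially"
    by (rule less_LiminfD)
  then show ?thesis
  proof (rule eventually_mono)
    fix n
    assume "ennreal ((1 - e) * (\<Prod>i<k. 1 / real (Suc (j i)))) < (\<integral>\<^sup>+\<omega>. (\<Prod>i<k. mcard (A n \<omega>) {a i..b i}) \<partial>M n)"
    also have "\<dots> \<le> (\<integral>\<^sup>+\<omega>. (\<Prod>i<k. mcard (A n \<omega>) (cell N (j i))) \<partial>M n)"
      by (intro nn_integral_mono prod_mono_ennreal mcard_mono sub)
    finally show "ennreal ((1 - e) * (\<Prod>i<k. 1 / real (Suc (j i))))
        \<le> (\<integral>\<^sup>+\<omega>. (\<Prod>i<k. mcard (A n \<omega>) (cell N (j i))) \<partial>M n)" by (rule less_imp_le)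
  qed
qed

text \<open>Compares the stick-breaking bound of \<open>emeasure_stick_box_le\<close>, rescaled by
  \<open>N\<close>, with weight times the intensities \<open>1 / (j i + 1)\<close>. Only rounding
  separates them: factor by factor one loses \<open>j i / (j i + 1)\<close>, at least
  \<open>1 - 1/y\<close>, and \<open>(x - i) / x\<close>, at least \<open>1 - k/y\<close>, where
  \<open>x\<close> is the remaining budget and \<open>x \<ge> y\<close>.\<close>

lemma tuple_weight_ge:
  assumes y: "real k < y" "1 < y"
    and j: "\<And>i. i < k \<Longrightarrow> y \<le> real (Suc (j i))" "real (\<Sum>i<k. j i) \<le> real N - y"
    and e: "1 - e \<le> ((1 - 1 / y) * (1 - real k / y)) ^ k"
  shows "(1 - e) * (\<Prod>i<k. 1 / (real N - real (\<Sum>l<i. Suc (j l))))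
    \<le> tuple_weight N k j * (\<Prod>i<k. 1 / real (Suc (j i)))"
proof -
  let ?q = "(1 - 1 / y) * (1 - real k / y)"
  have Sle: "(\<Sum>l<i. j l) \<le> (\<Sum>l<k. j l)" if "i < k" for i using that by (intro sum_mono2) auto
  have x: "y \<le> real N - real (\<Sum>l<i. j l)" if "i < k" for i
    using of_nat_mono[OF Sle[OF that], where 'a=real] j(2) by linarith
  \<comment> \<open>Using right instead of left ends lowers the budget by one unit per earlier
    cell.\<close>
  have d: "real N - real (\<Sum>l<i. Suc (j l)) = real N - real (\<Sum>l<i. j l) - real i" for i
    by (induction i) auto
  have dpos: "0 < real N - real (\<Sum>l<i. Suc (j l))" if "i < k" for i
    unfolding d using x[OF that] y that by linarith
  have q: "0 \<le> ?q" using y by (intro mult_nonneg_nonneg) auto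
  have "(1 - e) * (\<Prod>i<k. 1 / (real N - real (\<Sum>l<i. Suc (j l))))
      \<le> ?q ^ k * (\<Prod>i<k. 1 / (real N - real (\<Sum>l<i. Suc (j l))))"
    using dpos by (intro mult_right_mono e prod_nonneg) (auto intro: less_imp_le)
  also have "\<dots> = (\<Prod>i<k. ?q * (1 / (real N - real (\<Sum>l<i. Suc (j l)))))"
    by (subst prod.distrib[of "\<lambda>_. ?q"]) (simp only: prod_constant card_lessThan)
  also have "\<dots> \<le> (\<Prod>i<k. real (j i) / real (N - (\<Sum>l<i. j l)) * (1 / real (Suc (j i))))"
  proof (rule prod_mono, intro conjI)
    fix i assume "i \<in> {..<k}"
    then have i: "i < k" by simp
    let ?x = "real N - real (\<Sum>l<i. j l)"
    have x': "y \<le> ?x" "0 < ?x" "0 < ?x - real i" using x[OF i] y i by linarith+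
    show "0 \<le> ?q * (1 / (real N - real (\<Sum>l<i. Suc (j l))))" using q dpos[OF i] by (auto intro!: mult_nonneg_nonneg less_imp_le)
    have "(\<Sum>l<i. j l) \<le> N" using x' by (simp only: of_nat_le_iff[symmetric, where 'a=real])
    then have dx: "real (N - (\<Sum>l<i. j l)) = ?x" by (rule of_nat_diff)
    have "1 - 1 / y \<le> 1 - 1 / real (Suc (j i))" using j(1)[OF i] y by (intro diff_left_mono divide_left_mono) auto
    also have "\<dots> = real (j i) / real (Suc (j i))" by (simp add: field_simps)
    finally have 1: "1 - 1 / y \<le> real (j i) / real (Suc (j i))" .
    have "real i / ?x \<le> real k / y" using x' y i by (intro frac_le) auto
    then have 2: "1 - real k / y \<le> (?x - real i) / ?x" using x' by (simp add: diff_divide_distrib)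
    have "?q * (1 / (?x - real i)) \<le> real (j i) / real (Suc (j i)) * ((?x - real i) / ?x) * (1 / (?x - real i))"
      using 1 2 x' y by (intro mult_right_mono mult_mono) auto
    also have "\<dots> = real (j i) / ?x * (1 / real (Suc (j i)))" using x' by simp
    finally show "?q * (1 / (real N - real (\<Sum>l<i. Suc (j l)))) \<le> real (j i) / real (N - (\<Sum>l<i. j l)) * (1 / real (Suc (j i)))"
      unfolding d dx .
  qed
  also have "\<dots> = tuple_weight N k j * (\<Prod>i<k. 1 / real (Suc (j i)))"
    by (simp only: prod.distrib tuple_weight_def)
  finally show ?thesis .
qed

text \<open>Sample points for which a grid of mesh below \<open>\<eta>\<close> puts the first
  \<open>k\<close> sticks into distinct cells other than cell 0; the bound on the remaining mass
  keeps the denominators of the weights large.\<close>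

definition spread :: "nat \<Rightarrow> real \<Rightarrow> (nat \<Rightarrow> real) set" where
  "spread k \<eta> = {u \<in> space uniform01_seq. (\<forall>i<k. \<eta> \<le> stick u i) \<and> \<eta> \<le> (\<Prod>i<k. u i) \<and>
     (\<forall>i<k. \<forall>l<i. \<eta> \<le> \<bar>stick u l - stick u i\<bar>)}"

lemma spread_antimono:
  assumes "\<eta>' \<le> \<eta>"
  shows "spread k \<eta> \<subseteq> spread k \<eta>'"
proof
  fix u assume u: "u \<in> spread k \<eta>"
  show "u \<in> spread k \<eta>'"
    unfolding spread_def
  proof (intro CollectI conjI allI impI)
    show "u \<in> space uniform01_seq" "\<eta>' \<le> (\<Prod>i<k. u i)" using u assms by (auto simp: spread_def)
    show "\<eta>' \<le> stick u i" if "i < k" for i using u assms that order_trans by (fastforce simp: spread_def)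
    show "\<eta>' \<le> \<bar>stick u l - stick u i\<bar>" if "i < k" "l < i" for i l
      using u assms that order_trans by (fastforce simp: spread_def)
  qed
qed

lemma sets_spread [measurable]: "spread k \<eta> \<in> sets uniform01_seq"
  unfolding spread_def by measurable

text \<open>Almost surely the finitely many quantities bounded in \<open>spread\<close> are all
  positive, so the events increase to one of probability 1 as \<open>\<eta>\<close> decreases to
  0.\<close>

lemma spread_prob:
  assumes "0 < e" "0 < d"
  shows "\<exists>\<eta>. 0 < \<eta> \<and> \<eta> \<le> d \<and> 1 - e < measure uniform01_seq (spread k \<eta>)"
proof -
  interpret prob_space uniform01_seq by (rule prob_space_uniform01_seq)
  let ?S = "\<lambda>n. spread k (d / real (Suc n))"
  have inc: "incseq ?S"
  proof (rule incseq_SucI)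
    fix n
    have "d / real (Suc (Suc n)) \<le> d / real (Suc n)" using assms by (intro divide_left_mono) auto
    then show "?S n \<subseteq> ?S (Suc n)" by (rule spread_antimono)
  qed
  have "AE u in uniform01_seq. \<forall>i\<in>{..<k}. \<forall>l\<in>{..<i}. stick u l \<noteq> stick u i"
    by (intro AE_finite_allI AE_stick_neq) auto
  then have "AE u in uniform01_seq. u \<in> (\<Union>n. ?S n)"
  proof (rule AE_mp, intro AE_I2 impI)
    fix u assume u: "u \<in> space uniform01_seq" and ne: "\<forall>i\<in>{..<k}. \<forall>l\<in>{..<i}. stick u l \<noteq> stick u i"
    let ?V = "insert (\<Prod>i<k. u i) ((\<lambda>i. stick u i) ` {..<k} \<union> (\<lambda>(l,i). \<bar>stick u l - stick u i\<bar>) ` (SIGMA l:{..<k}. {i. l < i \<and> i < k}))"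
    have fin: "finite ?V" by auto
    have "\<forall>x\<in>?V. 0 < x"
      using u ne by (auto simp: space_uniform01_seq intro!: prod_pos stick_bounds)
    then have "0 < Min ?V" using fin by (subst Min_gr_iff) auto
    then obtain n where "inverse (real (Suc n)) < Min ?V / d" using assms reals_Archimedean[of "Min ?V / d"] by auto
    then have n: "d / real (Suc n) < Min ?V" using assms by (simp add: field_simps)
    have V: "d / real (Suc n) \<le> x" if "x \<in> ?V" for x using Min_le[OF fin that] n by linarith
    have "u \<in> ?S n"
      unfolding spread_def
    proof (intro CollectI conjI allI impI V u)
      fix i l assume "i < k" "l < i"
      then have "(l, i) \<in> (SIGMA l:{..<k}. {i. l < i \<and> i < k})" by auto
      then show "\<bar>stick u l - stick u i\<bar> \<in> ?V" by force
    qed auto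
    then show "u \<in> (\<Union>n. ?S n)" by blast
  qed
  then have "prob (\<Union>n. ?S n) = 1" by (subst prob_eq_1) auto
  moreover have "(\<lambda>n. prob (?S n)) \<longlonglongrightarrow> prob (\<Union>n. ?S n)"
    using inc by (intro finite_Lim_measure_incseq) auto
  ultimately have "eventually (\<lambda>n. 1 - e < prob (?S n)) sequentially"
    using assms by (intro order_tendstoD(1)[where y=1]) auto
  then obtain n where "1 - e < prob (?S n)" by (auto simp: eventually_sequentially)
  moreover have "d / real (Suc n) \<le> d" using assms by (simp add: field_simps)
  ultimately show ?thesis using assms by (intro exI[of _ "d / real (Suc n)"]) auto
qed

text \<open>The cube \<open>[0,1]\<close> to the power of the naturals is compact, so
  \<open>H\<close> is uniformly continuous on it, and a coordinatewise bound controls the product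
  metric.\<close>

lemma continuous_on_sequences_uniform:
  fixes H :: "(nat \<Rightarrow> real) \<Rightarrow> real"
  assumes "continuous_on UNIV H" "0 < e"
  shows "\<exists>\<delta>>0. \<forall>x y. (\<forall>i. x i \<in> {0..1} \<and> y i \<in> {0..1} \<and> dist (x i) (y i) \<le> \<delta>) \<longrightarrow> dist (H x) (H y) \<le> e"
proof -
  let ?K = "PiE UNIV (\<lambda>_::nat. {0..1::real})"
  have "compact ?K" 
    unfolding compactin_euclidean_iff[symmetric] euclidean_product_topology[symmetric] compactin_PiE
    by (auto simp: compactin_euclidean_iff)
  then have "uniformly_continuous_on ?K H"
    using continuous_on_subset[OF assms(1)] by (intro compact_uniformly_continuous) auto
  then obtain d where d: "0 < d" "\<And>x y. x \<in> ?K \<Longrightarrow> y \<in> ?K \<Longrightarrow> dist y x < d \<Longrightarrow> dist (H y) (H x) < e"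
    unfolding uniformly_continuous_on_def using assms(2) by metis
  obtain n where n: "(1/2) ^ n < d / 2" using real_arch_pow_inv[of "d/2" "1/2"] d by auto
  show ?thesis
  \<comment> \<open>The first coordinates contribute at most \<open>2 * d/8\<close> and the tail
    less than \<open>d/2\<close>, together less than \<open>d\<close>.\<close>
  proof (intro exI[of _ "d/8"] conjI allI impI)
    fix x y :: "nat \<Rightarrow> real"
    assume xy: "\<forall>i. x i \<in> {0..1} \<and> y i \<in> {0..1} \<and> dist (x i) (y i) \<le> d/8"
    have "dist x y \<le> 2 * Max {dist (x (from_nat l)) (y (from_nat l)) |l. l \<le> n} + (1/2) ^ n"
      by (rule dist_fun_le_dist_first_terms)
    also have "Max {dist (x (from_nat l)) (y (from_nat l)) |l. l \<le> n} \<le> d/8"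
      using xy by (subst Max_le_iff) auto
    finally have "dist x y < d" using n d by simp
    then show "dist (H x) (H y) \<le> e" using d(2)[of y x] xy by (auto simp: less_imp_le PiE_iff)
  qed (use d in auto)
qed

section \<open>Convergence\<close>

text \<open>\<open>X\<close> is the expectation of a lower approximation of \<open>H\<close> that is
  constant on cell tuples. The error \<open>2 * e\<close> is the oscillation of \<open>H\<close> on
  a tuple, and \<open>2 * e * C\<close> pays for an exceptional event of probability at most
  \<open>2 * e\<close>. One factor \<open>1 - e\<close> comes from rounding in the weights, the
  other from approximating cells by closed intervals.\<close>

lemma expectation_ranked_lower_bound:
  fixes M :: "nat \<Rightarrow> 'a measure" and A :: "nat \<Rightarrow> 'a \<Rightarrow> real \<Rightarrow> nat"
    and H :: "(nat \<Rightarrow> real) \<Rightarrow> real"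
  assumes rm: "\<And>n. random_multisubset (M n) (A n)"
    and ms: "\<And>n. AE \<omega> in M n. msum (A n \<omega>) \<le> 1"
    and hyp: "\<And>k a b. 1 \<le> k \<Longrightarrow> admissible_intervals k a b \<Longrightarrow>
      ennreal (\<Prod>i<k. (b i - a i) / b i) \<le> liminf (\<lambda>n. \<integral>\<^sup>+\<omega>. (\<Prod>i<k. mcard (A n \<omega>) {a i..b i}) \<partial>M n)"
    and H: "continuous_on UNIV H" "\<And>x. 0 \<le> H x" "\<And>x. H x \<le> C"
    and e: "0 < e" "e < 1"
  shows "\<exists>X. (\<integral>\<^sup>+u. H (ranked (stick_multiset u)) \<partial>uniform01_seq) \<le> X + ennreal (2 * e + 2 * e * C) \<and>
    eventually (\<lambda>n. ennreal ((1 - e)\<^sup>2) * X \<le> (\<integral>\<^sup>+\<omega>. H (ranked (A n \<omega>)) \<partial>M n)) sequentially"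
proof -

  \<comment> \<open>Choice of the typical event\<close>
  interpret U: prob_space uniform01_seq by (rule prob_space_uniform01_seq)
  let ?h = "\<lambda>u. H (ranked (stick_multiset u))"
  have [measurable]: "H \<in> borel_measurable borel" using H(1) by (rule borel_measurable_continuous_onI)
  note [measurable] = ranked_measurable[OF random_multisubset_stick_multiset] ranked_measurable[OF rm]
  have hC: "0 \<le> C" using order_trans[OF H(2) H(3)] .
  obtain \<delta> where \<delta>: "0 < \<delta>" and unif:
    "\<And>x y. (\<And>i. x i \<in> {0..1} \<and> y i \<in> {0..1} \<and> dist (x i) (y i) \<le> \<delta>) \<Longrightarrow> dist (H x) (H y) \<le> e"
    using continuous_on_sequences_uniform[OF H(1) e(1)] by metis
  \<comment> \<open>After \<open>k\<close> sticks the mass left reaches \<open>\<delta>/4\<close>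
    with probability at most \<open>e\<close>; the successor ensures
    \<open>k \<ge> 1\<close>.\<close>
  obtain k0 where "(1/2) ^ k0 < e * (\<delta>/4)" using real_arch_pow_inv[of "e * (\<delta>/4)" "1/2"] e \<delta> by auto
  define k where "k = Suc k0"
  have "(1/2::real) ^ k \<le> (1/2) ^ k0" unfolding k_def by simp
  then have k: "1 \<le> k" "(1/2) ^ k / (\<delta>/4) \<le> e"
    using \<open>(1/2) ^ k0 < e * (\<delta>/4)\<close> \<delta> by (auto simp: k_def field_simps)
  define R where "R = {u\<in>space uniform01_seq. \<delta>/4 \<le> (\<Prod>i<k. u i)}"
  have R_sets [measurable]: "R \<in> sets uniform01_seq" unfolding R_def by measurable
  have "emeasure uniform01_seq R \<le> ennreal ((1/2) ^ k / (\<delta>/4))"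
    unfolding R_def using \<delta> by (intro emeasure_prod_ge_le) simp
  then have "ennreal (U.prob R) \<le> ennreal e" using k(2) unfolding U.emeasure_eq_measure
    by (meson ennreal_leI order_trans)
  then have PR: "U.prob R \<le> e" using e by simp
  obtain \<eta> where \<eta>: "0 < \<eta>" "\<eta> \<le> \<delta>/4" "1 - e < U.prob (spread k \<eta>)"
    using spread_prob[OF e(1), of "\<delta>/4" k] \<delta> by auto
  define G where "G = spread k \<eta> - R"
  have G_sets [measurable]: "G \<in> sets uniform01_seq" unfolding G_def by measurable
  have "U.prob (spread k \<eta>) \<le> U.prob (G \<union> R)" unfolding G_def by (intro U.finite_measure_mono) auto
  also have "\<dots> \<le> U.prob G + U.prob R" by (rule measure_subadditive) auto
  finally have PG: "1 - 2 * e \<le> U.prob G" using \<eta> PR by simp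

  \<comment> \<open>Choice of the mesh\<close>
  have "((\<lambda>y::real. ((1 - 1 / y) * (1 - real k / y)) ^ k) \<longlongrightarrow> ((1 - 0) * (1 - 0)) ^ k) at_top"
    by (intro tendsto_intros tendsto_divide_0[OF tendsto_const] filterlim_at_top_imp_at_infinity filterlim_ident)
  then have "eventually (\<lambda>y::real. 1 - e < ((1 - 1 / y) * (1 - real k / y)) ^ k \<and> real k < y \<and> 1 < y) at_top"
    using e by (intro eventually_conj eventually_gt_at_top order_tendstoD(1)[where y=1]) auto
  \<comment> \<open>The parameter \<open>y\<close> of \<open>tuple_weight_ge\<close> is
    \<open>N * \<eta>\<close>, which tends to infinity with \<open>N\<close>.\<close>
  moreover have "filterlim (\<lambda>N. real N * \<eta>) at_top sequentially"
    using \<eta>(1) by (intro filterlim_at_top_mult_tendsto_pos[OF tendsto_const _ filterlim_real_sequentially]) auto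
  ultimately have "eventually (\<lambda>N. 1 - e < ((1 - 1 / (real N * \<eta>)) * (1 - real k / (real N * \<eta>))) ^ k \<and>
      real k < real N * \<eta> \<and> 1 < real N * \<eta>) sequentially"
    by (rule eventually_compose_filterlim)
  then obtain N :: nat where N: "real k < real N * \<eta>" "1 < real N * \<eta>"
    "1 - e \<le> ((1 - 1 / (real N * \<eta>)) * (1 - real k / (real N * \<eta>))) ^ k"
    by (auto simp: eventually_sequentially less_imp_le)
  let ?y = "real N * \<eta>"
  have N0: "0 < N" using N(2) \<eta> by (cases N) auto

  \<comment> \<open>Cell tuples of typical stick sequences\<close>
  have "\<exists>j. j \<in> {..<k} \<rightarrow>\<^sub>E {..<N} \<and> (\<forall>i<k. stick u i \<in> cell N (j i))" if "u \<in> space uniform01_seq" for u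
  proof -
    have "\<exists>l<N. stick u i \<in> cell N l" for i
      using that by (intro cell_exists N0 stick_bounds) (auto simp: space_uniform01_seq)
    then obtain j where "\<And>i. j i < N \<and> stick u i \<in> cell N (j i)" by metis
    then show ?thesis by (intro exI[of _ "restrict j {..<k}"]) auto
  qed
  then obtain idx where idx: "\<And>u. u \<in> space uniform01_seq \<Longrightarrow> idx u \<in> {..<k} \<rightarrow>\<^sub>E {..<N}"
    "\<And>u i. u \<in> space uniform01_seq \<Longrightarrow> i < k \<Longrightarrow> stick u i \<in> cell N (idx u i)" by metis
  define T where "T = idx ` G"
  \<comment> \<open>One typical sample point per tuple serves as reference; its value of
    \<open>H\<close> minus \<open>e\<close> replaces the infimum over the tuple.\<close>
  define rep where "rep j = (SOME u. u \<in> G \<and> idx u = j)" for j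
  have rep: "rep j \<in> G" "idx (rep j) = j" if "j \<in> T" for j
    using someI_ex[of "\<lambda>u. u \<in> G \<and> idx u = j"] that by (auto simp: T_def rep_def)
  have Gsp: "G \<subseteq> space uniform01_seq" by (auto simp: G_def spread_def)
  \<comment> \<open>Read off from the reference point: sticks at least \<open>\<eta>\<close> give
    large indices, gaps of \<open>\<eta> > 1/N\<close> give distinct ones, and the mass left is at
    least \<open>\<eta>\<close>, for the budget, but below \<open>\<delta>/4\<close>, so that the
    left ends sum to nearly 1.\<close>
  have T_props: "inj_on j {..<k} \<and> (\<forall>i<k. 0 < j i \<and> ?y \<le> real (Suc (j i))) \<and>
      real (\<Sum>i<k. j i) \<le> real N - ?y \<and> (\<Sum>i<k. Suc (j i)) < N \<and>
      1 - \<delta>/2 \<le> (\<Sum>i<k. real (j i) / real N)" if jT: "j \<in> T" for j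
  proof -
    define u where "u = rep j"
    have u: "u \<in> G" "u \<in> space uniform01_seq" "idx u = j" using rep[OF jT] Gsp by (auto simp: u_def)
    have c: "real (j i) < real N * stick u i" "real N * stick u i \<le> real (Suc (j i))" if "i < k" for i
      using idx(2)[OF u(2) that] N0 u(3) by (simp_all add: cell_def field_simps)
    have sp: "\<And>i. i < k \<Longrightarrow> \<eta> \<le> stick u i" "\<eta> \<le> (\<Prod>i<k. u i)" "(\<Prod>i<k. u i) < \<delta>/4"
      "\<And>i l. i < k \<Longrightarrow> l < i \<Longrightarrow> \<eta> \<le> \<bar>stick u l - stick u i\<bar>"
      using u(1,2) by (auto simp: G_def R_def spread_def)
    have S: "(\<Sum>i<k. real N * stick u i) = real N * (1 - (\<Prod>i<k. u i))"
      by (simp add: sum_stick sum_distrib_left[symmetric])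
    have y: "?y \<le> real (Suc (j i))" if "i < k" for i
    proof -
      have "?y \<le> real N * stick u i" using sp(1)[OF that] by (intro mult_left_mono) auto
      with c(2)[OF that] show ?thesis by linarith
    qed
    have ne: "j l \<noteq> j i" if "i < k" "l < i" for i l
    proof
      assume eq: "j l = j i"
      have "\<bar>real N * stick u l - real N * stick u i\<bar> < 1"
        using c[of i] c[of l] that eq by (simp add: abs_less_iff)
      moreover have "?y \<le> real N * \<bar>stick u l - stick u i\<bar>" using sp(4)[OF that] by (intro mult_left_mono) auto
      ultimately show False using N(2) by (simp add: abs_mult right_diff_distrib[symmetric])
    qed
    have "inj_on j {..<k}"
      by (rule linorder_inj_onI) (use ne in auto)
    moreover have "0 < j i" if "i < k" for i using y[OF that] N(2) by (cases "j i") auto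
    moreover have Sj: "real (\<Sum>i<k. j i) \<le> real N - ?y"
    proof -
      have "real (\<Sum>i<k. j i) \<le> (\<Sum>i<k. real N * stick u i)"
        unfolding of_nat_sum using c(1) by (intro sum_mono less_imp_le) auto
      also have "\<dots> \<le> real N * (1 - \<eta>)" unfolding S using sp(2) by (intro mult_left_mono) auto
      finally show ?thesis by (simp add: algebra_simps)
    qed
    moreover have "(\<Sum>i<k. Suc (j i)) < N"
    proof -
      have "real (\<Sum>i<k. Suc (j i)) = real (\<Sum>i<k. j i) + real k" by (simp add: sum.distrib)
      also have "\<dots> < real N" using Sj N(1) by linarith
      finally show ?thesis by (simp only: of_nat_less_iff)
    qed
    moreover have "1 - \<delta>/2 \<le> (\<Sum>i<k. real (j i) / real N)"
    proof -
      have "real N * (1 - \<delta>/4) \<le> real N * (1 - (\<Prod>i<k. u i))" using sp(3) by (intro mult_left_mono) auto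
      also have "\<dots> \<le> (\<Sum>i<k. real (Suc (j i)))" unfolding S[symmetric] using c(2) by (intro sum_mono) auto
      also have "\<dots> = (\<Sum>i<k. real (j i)) + real k" by (simp add: sum.distrib)
      finally have "real N * (1 - \<delta>/4) \<le> (\<Sum>i<k. real (j i)) + real N * (\<delta>/4)"
        using N(1) mult_left_mono[OF \<eta>(2), of "real N"] by simp
      then have "real N * (1 - \<delta>/2) \<le> (\<Sum>i<k. real (j i))" by (simp add: algebra_simps)
      then show ?thesis using N0 by (simp add: sum_divide_distrib[symmetric] field_simps)
    qed
    ultimately show ?thesis using y by blast
  qed
  have T_sub: "T \<subseteq> inj_tuples N k"
    using idx(1) Gsp T_props by (auto simp: T_def inj_tuples_def)
  have finT: "finite T" using T_sub finite_inj_tuples by (rule finite_subset)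

  \<comment> \<open>Values of \<open>H\<close> on multisets meeting the cells\<close>
  define v where "v j = max 0 (?h (rep j) - e)" for j
  have close: "dist (H (ranked m)) (?h (rep j)) \<le> e"
    if "j \<in> T" "msum m \<le> 1" "\<And>i. i < k \<Longrightarrow> mcard m (cell N (j i)) \<noteq> 0" for j m
  proof (rule unif)
    fix r
    have u: "rep j \<in> space uniform01_seq" using rep[OF that(1)] Gsp by auto
    note p = T_props[OF that(1)]
    have 1: "0 < real (j i) / real N \<and> real (j i) / real N < real (Suc (j i)) / real N \<and>
        real (Suc (j i)) / real N \<le> real (j i) / real N + 1 / real N \<and> real (Suc (j i)) / real N \<le> 1"
      if "i < k" for i
    proof -
      have "Suc (j i) \<le> (\<Sum>i<k. Suc (j i))" using that by (intro member_le_sum) auto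
      then have "Suc (j i) \<le> N" using p by linarith
      then have "real (Suc (j i)) / real N \<le> 1" using N0 by (simp add: divide_le_eq_1)
      then show ?thesis using p that N0 by (auto simp: add_divide_distrib divide_strict_right_mono)
    qed
    have 2: "disjoint_family_on (\<lambda>i. {real (j i) / real N<..real (Suc (j i)) / real N}) {..<k}"
      unfolding disjoint_family_on_def cell_def[symmetric]
      using p by (auto intro!: disjoint_cells N0 simp: inj_on_def)
    \<comment> \<open>The left ends miss at most \<open>\<delta>/2\<close> of the mass and the cells
      have width \<open>1/N\<close>, below \<open>\<delta>/2\<close>.\<close>
    have "dist (ranked m r) (ranked (stick_multiset (rep j)) r) \<le> \<delta>/2 + 1 / real N"
    proof (rule ranked_dist_le[OF that(2) msum_stick_multiset[OF u] 1 2])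
      show "mcard (stick_multiset (rep j)) {real (j i) / real N<..real (Suc (j i)) / real N} \<noteq> 0" if "i < k" for i
        using idx(2)[OF u that] rep(2)[OF \<open>j \<in> T\<close>] by (intro mcard_stick_multiset_nonzero[OF u]) (simp add: cell_def)
    qed (use p \<delta> that(3) in \<open>auto simp: cell_def\<close>)
    also have "1 / real N \<le> \<delta>/2"
    proof -
      have "1 / real N < \<eta>" using N(2) N0 by (simp add: divide_less_eq mult.commute)
      then show ?thesis using \<eta>(2) \<delta> by linarith
    qed
    finally show "ranked m r \<in> {0..1} \<and> ranked (stick_multiset (rep j)) r \<in> {0..1} \<and>
        dist (ranked m r) (ranked (stick_multiset (rep j)) r) \<le> \<delta>"
      by (simp add: ranked_bounds)
  qed

  \<comment> \<open>Cell probabilities of the sticks\<close>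
  define Q where "Q j = {u\<in>space uniform01_seq. \<forall>i<k. stick u i \<in> cell N (j i)}" for j
  have Q_sets [measurable]: "Q j \<in> sets uniform01_seq" for j unfolding Q_def cell_def by measurable
  have cells_prob: "ennreal (1 - e) * emeasure uniform01_seq (Q j)
      \<le> ennreal (tuple_weight N k j * (\<Prod>i<k. 1 / real (Suc (j i))))" if "j \<in> T" for j
  proof -
    note p = T_props[OF that]
    have S: "real (\<Sum>l<i. Suc (j l)) / real N < 1" if "i < k" for i
    proof -
      have "(\<Sum>l<i. Suc (j l)) \<le> (\<Sum>l<k. Suc (j l))" using that by (intro sum_mono2) auto
      then have "(\<Sum>l<i. Suc (j l)) < N" using p by linarith
      then show ?thesis using N0 by (simp only: divide_less_eq_1_pos of_nat_0_less_iff of_nat_less_iff)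
    qed
    have "emeasure uniform01_seq (Q j) \<le> ennreal (\<Prod>i<k. (real (Suc (j i)) / real N - real (j i) / real N) /
        (1 - (\<Sum>l<i. real (Suc (j l)) / real N)))"
      unfolding Q_def cell_def
      using S by (intro emeasure_stick_box_le) (auto intro!: divide_right_mono simp: sum_divide_distrib simp del: of_nat_Suc)
    also have "(\<Prod>i<k. (real (Suc (j i)) / real N - real (j i) / real N) / (1 - (\<Sum>l<i. real (Suc (j l)) / real N)))
        = (\<Prod>i<k. 1 / (real N - real (\<Sum>l<i. Suc (j l))))"
    proof (rule prod.cong)
      fix i
      have "real (Suc (j i)) / real N - real (j i) / real N = 1 / real N"
        by (simp add: diff_divide_distrib[symmetric])
      moreover have "1 - (\<Sum>l<i. real (Suc (j l)) / real N) = (real N - real (\<Sum>l<i. Suc (j l))) / real N"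
        using N0 by (simp add: diff_divide_distrib sum_divide_distrib del: of_nat_Suc)
      ultimately show "(real (Suc (j i)) / real N - real (j i) / real N) / (1 - (\<Sum>l<i. real (Suc (j l)) / real N))
          = 1 / (real N - real (\<Sum>l<i. Suc (j l)))"
        using N0 by (simp del: of_nat_Suc of_nat_sum)
    qed simp
    finally have "ennreal (1 - e) * emeasure uniform01_seq (Q j)
        \<le> ennreal (1 - e) * ennreal (\<Prod>i<k. 1 / (real N - real (\<Sum>l<i. Suc (j l))))"
      by (rule mult_left_mono) simp
    also have "\<dots> = ennreal ((1 - e) * (\<Prod>i<k. 1 / (real N - real (\<Sum>l<i. Suc (j l)))))"
      using e by (intro ennreal_mult'[symmetric]) simp
    also have "\<dots> \<le> ennreal (tuple_weight N k j * (\<Prod>i<k. 1 / real (Suc (j i))))"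
      using p by (intro ennreal_leI tuple_weight_ge[OF N(1,2) _ _ N(3)]) auto
    finally show ?thesis .
  qed

  \<comment> \<open>Approximation of the limiting expectation\<close>
  define X where "X = (\<integral>\<^sup>+u. (\<Sum>j\<in>T. ennreal (v j) * indicator (Q j) u) \<partial>uniform01_seq)"
  have X: "X = (\<Sum>j\<in>T. ennreal (v j) * emeasure uniform01_seq (Q j))"
    unfolding X_def by (subst nn_integral_sum) (auto simp: nn_integral_cmult_indicator)
  have "(\<integral>\<^sup>+u. ?h u \<partial>uniform01_seq) \<le> (\<integral>\<^sup>+u. (\<Sum>j\<in>T. ennreal (v j) * indicator (Q j) u) +
      (ennreal (2 * e) + ennreal C * indicator (space uniform01_seq - G) u) \<partial>uniform01_seq)"
  proof (rule nn_integral_mono)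
    fix u assume u: "u \<in> space uniform01_seq"
    show "ennreal (?h u) \<le> (\<Sum>j\<in>T. ennreal (v j) * indicator (Q j) u) +
      (ennreal (2 * e) + ennreal C * indicator (space uniform01_seq - G) u)"
    proof (cases "u \<in> G")
      case True
      \<comment> \<open>A typical point lies in the box of its own tuple, whose term alone already
        gives the bound.\<close>
      let ?j = "idx u"
      have jT: "?j \<in> T" using True by (auto simp: T_def)
      have uQ: "u \<in> Q ?j" using u idx(2)[OF u] by (auto simp: Q_def)
      have "dist (?h u) (?h (rep ?j)) \<le> e"
        by (rule close[OF jT msum_stick_multiset[OF u]])
          (use idx(2)[OF u] in \<open>auto intro!: mcard_stick_multiset_nonzero[OF u]\<close>)
      then have "?h u \<le> v ?j + 2 * e" by (auto simp: v_def dist_real_def)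
      then have "ennreal (?h u) \<le> ennreal (v ?j + 2 * e)" by (rule ennreal_leI)
      also have "\<dots> = ennreal (v ?j) + ennreal (2 * e)" using e by (intro ennreal_plus) (auto simp: v_def)
      also have "ennreal (v ?j) \<le> (\<Sum>j\<in>T. ennreal (v j) * indicator (Q j) u)"
        using uQ member_le_sum[OF jT, of "\<lambda>j. ennreal (v j) * indicator (Q j) u"] finT by simp
      finally show ?thesis using True by simp
    next
      case False
      then have "ennreal (?h u) \<le> ennreal C * indicator (space uniform01_seq - G) u"
        using u H(3) by (auto intro: ennreal_leI)
      then show ?thesis by (metis (no_types, lifting) add_increasing zero_le)
    qed
  qed
  also have "\<dots> = X + (ennreal (2 * e) + ennreal C * emeasure uniform01_seq (space uniform01_seq - G))"
    unfolding X_def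
    by (subst nn_integral_add, simp, simp, subst nn_integral_add)
      (auto simp: nn_integral_cmult_indicator U.emeasure_space_1)
  also have "\<dots> \<le> X + (ennreal (2 * e) + ennreal C * ennreal (2 * e))"
    using PG by (intro add_left_mono mult_left_mono) (auto simp: U.emeasure_eq_measure U.prob_compl intro!: ennreal_leI)
  also have "ennreal (2 * e) + ennreal C * ennreal (2 * e) = ennreal (2 * e + 2 * e * C)"
    using e hC by (simp add: ennreal_mult'[symmetric] ennreal_plus[symmetric] ac_simps del: ennreal_plus)
  finally have 1: "(\<integral>\<^sup>+u. ?h u \<partial>uniform01_seq) \<le> X + ennreal (2 * e + 2 * e * C)" .

  \<comment> \<open>Lower bound for the given multisets\<close>
  have "eventually (\<lambda>n. \<forall>j\<in>T. ennreal ((1 - e) * (\<Prod>i<k. 1 / real (Suc (j i))))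
      \<le> (\<integral>\<^sup>+\<omega>. (\<Prod>i<k. mcard (A n \<omega>) (cell N (j i))) \<partial>M n)) sequentially"
    using T_props by (intro eventually_ball_finite finT ballI eventually_cell_intensity hyp k(1) N0 e) auto
  then have "eventually (\<lambda>n. ennreal ((1 - e)\<^sup>2) * X \<le> (\<integral>\<^sup>+\<omega>. H (ranked (A n \<omega>)) \<partial>M n)) sequentially"
  proof (rule eventually_mono)
    fix n
    assume n: "\<forall>j\<in>T. ennreal ((1 - e) * (\<Prod>i<k. 1 / real (Suc (j i))))
      \<le> (\<integral>\<^sup>+\<omega>. (\<Prod>i<k. mcard (A n \<omega>) (cell N (j i))) \<partial>M n)"
    have [measurable]: "(\<lambda>\<omega>. \<Prod>i<k. mcard (A n \<omega>) (cell N (j i))) \<in> borel_measurable (M n)" if "j \<in> T" for j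
    proof (rule borel_measurable_prod_ennreal)
      fix i assume "i \<in> {..<k}"
      then have "Suc (j i) \<le> N" using T_sub that by (auto simp: inj_tuples_def Suc_le_eq)
      then have "real (Suc (j i)) / real N \<le> 1" "0 \<le> real (j i) / real N" using N0 by auto
      then have "cell N (j i) \<subseteq> {0<..1}"
        unfolding cell_def subset_iff greaterThanAtMost_iff by (intro allI impI) linarith
      then show "(\<lambda>\<omega>. mcard (A n \<omega>) (cell N (j i))) \<in> borel_measurable (M n)"
        using rm[of n] by (auto simp: random_multisubset_def cell_def)
    qed
    have "ennreal ((1 - e)\<^sup>2) * X = (\<Sum>j\<in>T. ennreal (v j) * (ennreal (1 - e) * (ennreal (1 - e) * emeasure uniform01_seq (Q j))))"
      unfolding X using e by (simp add: sum_distrib_left power2_eq_square ennreal_mult' ac_simps)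
    also have "\<dots> \<le> (\<Sum>j\<in>T. ennreal (v j) * (ennreal (1 - e) * ennreal (tuple_weight N k j * (\<Prod>i<k. 1 / real (Suc (j i))))))"
      by (intro sum_mono mult_left_mono cells_prob) auto
    also have "\<dots> = (\<Sum>j\<in>T. ennreal (v j * tuple_weight N k j) * ennreal ((1 - e) * (\<Prod>i<k. 1 / real (Suc (j i)))))"
    proof (rule sum.cong)
      fix j
      have "0 \<le> v j" "0 \<le> tuple_weight N k j" "0 \<le> (\<Prod>i<k. 1 / real (Suc (j i)))"
        by (auto simp: v_def intro!: tuple_weight_nonneg prod_nonneg)
      then show "ennreal (v j) * (ennreal (1 - e) * ennreal (tuple_weight N k j * (\<Prod>i<k. 1 / real (Suc (j i)))))
          = ennreal (v j * tuple_weight N k j) * ennreal ((1 - e) * (\<Prod>i<k. 1 / real (Suc (j i))))"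
        using e by (simp add: ennreal_mult ac_simps)
    qed simp
    also have "\<dots> \<le> (\<Sum>j\<in>T. ennreal (v j * tuple_weight N k j) * (\<integral>\<^sup>+\<omega>. (\<Prod>i<k. mcard (A n \<omega>) (cell N (j i))) \<partial>M n))"
      using n by (intro sum_mono mult_left_mono) auto
    also have "\<dots> = (\<integral>\<^sup>+\<omega>. (\<Sum>j\<in>T. ennreal (v j * tuple_weight N k j) * (\<Prod>i<k. mcard (A n \<omega>) (cell N (j i)))) \<partial>M n)"
      by (simp add: nn_integral_sum nn_integral_cmult)
    also have "\<dots> \<le> (\<integral>\<^sup>+\<omega>. H (ranked (A n \<omega>)) \<partial>M n)"
    proof (rule nn_integral_mono_AE, rule AE_mp[OF ms], intro AE_I2 impI)
      fix \<omega> assume m: "msum (A n \<omega>) \<le> 1"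
      show "(\<Sum>j\<in>T. ennreal (v j * tuple_weight N k j) * (\<Prod>i<k. mcard (A n \<omega>) (cell N (j i)))) \<le> ennreal (H (ranked (A n \<omega>)))"
      proof (rule sum_tuple_mcard_le[OF m N0 T_sub])
        fix j assume j: "j \<in> T" and hit: "\<And>i. i < k \<Longrightarrow> mcard (A n \<omega>) (cell N (j i)) \<noteq> 0"
        show "v j \<le> H (ranked (A n \<omega>))"
          using close[OF j m hit] H(2)[of "ranked (A n \<omega>)"] by (auto simp: v_def dist_real_def)
      qed (use T_props H(2) in \<open>auto simp: v_def\<close>)
    qed
    finally show "ennreal ((1 - e)\<^sup>2) * X \<le> (\<integral>\<^sup>+\<omega>. H (ranked (A n \<omega>)) \<partial>M n)" .
  qed
  with 1 show ?thesis by blast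
qed

text \<open>This is \<open>ln x \<le> x - 1\<close> at \<open>x = a/b\<close>; it reduces the
  logarithmic hypothesis to the other one.\<close>

lemma ln_ge_one_minus_div:
  fixes a b :: real
  assumes "0 < a" "0 < b"
  shows "(b - a) / b \<le> ln (b / a)"
  using ln_add_one_self_le_self2[of "a / b - 1"] assms
  by (simp add: ln_div diff_divide_distrib)

lemma expectation_ranked_eventually_ge:
  fixes M :: "nat \<Rightarrow> 'a measure" and A :: "nat \<Rightarrow> 'a \<Rightarrow> real \<Rightarrow> nat"
    and H :: "(nat \<Rightarrow> real) \<Rightarrow> real"
  assumes rm: "\<And>n. random_multisubset (M n) (A n)"
    and ms: "\<And>n. AE \<omega> in M n. msum (A n \<omega>) \<le> 1"
    and hyp: "\<And>k a b. 1 \<le> k \<Longrightarrow> admissible_intervals k a b \<Longrightarrow>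
      ennreal (\<Prod>i<k. (b i - a i) / b i) \<le> liminf (\<lambda>n. \<integral>\<^sup>+\<omega>. (\<Prod>i<k. mcard (A n \<omega>) {a i..b i}) \<partial>M n)"
    and H: "continuous_on UNIV H" "\<And>x. 0 \<le> H x" "\<And>x. H x \<le> C"
    and r: "0 < r"
  shows "eventually (\<lambda>n. (\<integral>u. H (ranked (stick_multiset u)) \<partial>uniform01_seq) - r \<le> (\<integral>\<omega>. H (ranked (A n \<omega>)) \<partial>M n)) sequentially"
proof -
  interpret U: prob_space uniform01_seq by (rule prob_space_uniform01_seq)
  have [measurable]: "H \<in> borel_measurable borel" using H(1) by (rule borel_measurable_continuous_onI)
  note [measurable] = ranked_measurable[OF random_multisubset_stick_multiset] ranked_measurable[OF rm]
  have C: "0 \<le> C" using order_trans[OF H(2) H(3)] .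
  let ?E = "\<integral>u. H (ranked (stick_multiset u)) \<partial>uniform01_seq"
  \<comment> \<open>The total error is \<open>e * (2 + 4 * C)\<close>:
    \<open>2 * e + 2 * e * C\<close> from the approximation and \<open>2 * e * C\<close> for
    dropping the factor \<open>(1 - e)\<^sup>2\<close>.\<close>
  define e where "e = min (1/2) (r / (2 + 4 * C))"
  have "e \<le> r / (2 + 4 * C)" by (simp add: e_def)
  moreover have "0 < 2 + 4 * C" using C by simp
  ultimately have "e * (2 + 4 * C) \<le> r" by (simp only: pos_le_divide_eq)
  moreover have "0 < e" "e < 1" using r C by (auto simp: e_def)
  ultimately have e: "0 < e" "e < 1" "e * (2 + 4 * C) \<le> r" by auto
  have enn: "(\<integral>\<^sup>+u. H (ranked (stick_multiset u)) \<partial>uniform01_seq) = ennreal ?E"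
    by (intro nn_integral_eq_integral U.integrable_const_bound[where B=C]) (use H in auto)
  have "?E \<le> (\<integral>u. C \<partial>uniform01_seq)"
    by (intro integral_mono U.integrable_const_bound[where B=C]) (use H C in auto)
  then have EC: "?E \<le> C" by (simp add: U.prob_space)
  obtain X where X: "ennreal ?E \<le> X + ennreal (2 * e + 2 * e * C)"
    and ev: "eventually (\<lambda>n. ennreal ((1 - e)\<^sup>2) * X \<le> (\<integral>\<^sup>+\<omega>. H (ranked (A n \<omega>)) \<partial>M n)) sequentially"
    using expectation_ranked_lower_bound[OF rm ms hyp H e(1,2)] unfolding enn by blast
  let ?Y = "?E - (2 * e + 2 * e * C)"
  \<comment> \<open>Both sides are 0 when \<open>?Y\<close> is negative.\<close>
  have "ennreal ?Y = ennreal ?E - ennreal (2 * e + 2 * e * C)"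
    using e C by (intro ennreal_minus[symmetric]) auto
  also have "\<dots> \<le> X" using X by (simp add: ennreal_minus_le_iff add.commute)
  finally have YX: "ennreal ?Y \<le> X" .
  show ?thesis
    using ev
  proof (rule eventually_mono)
    fix n
    interpret P: prob_space "M n" using rm by (simp add: random_multisubset_def)
    let ?I = "\<integral>\<omega>. H (ranked (A n \<omega>)) \<partial>M n"
    assume "ennreal ((1 - e)\<^sup>2) * X \<le> (\<integral>\<^sup>+\<omega>. H (ranked (A n \<omega>)) \<partial>M n)"
    also have "(\<integral>\<^sup>+\<omega>. H (ranked (A n \<omega>)) \<partial>M n) = ennreal ?I"
      by (intro nn_integral_eq_integral P.integrable_const_bound[where B=C]) (use H in auto)
    finally have "ennreal ((1 - e)\<^sup>2) * ennreal ?Y \<le> ennreal ?I"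
      using YX by (meson mult_left_mono order_trans zero_le)
    then have "ennreal ((1 - e)\<^sup>2 * ?Y) \<le> ennreal ?I" by (simp add: ennreal_mult')
    moreover have I0: "0 \<le> ?I" using H(2) by simp
    ultimately have YI: "(1 - e)\<^sup>2 * ?Y \<le> ?I" by simp
    have "?Y - 2 * e * C \<le> ?I"
    \<comment> \<open>For \<open>?Y \<ge> 0\<close> the factor \<open>(1 - e)\<^sup>2\<close> costs
      at most \<open>2 * e * ?Y\<close>, and \<open>?Y \<le> C\<close>; for negative
      \<open>?Y\<close> nonnegativity of \<open>?I\<close> is enough.\<close>
    proof (cases "0 \<le> ?Y")
      case True
      have "0 \<le> 2 * e + 2 * e * C" using e C by simp
      then have "?Y \<le> C" using EC by linarith
      then have "2 * e * ?Y \<le> 2 * e * C" using e by (intro mult_left_mono) auto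
      moreover have "0 \<le> e\<^sup>2 * ?Y" using True by simp
      moreover have "(1 - e)\<^sup>2 * ?Y = ?Y - 2 * e * ?Y + e\<^sup>2 * ?Y" by (simp add: power2_eq_square algebra_simps)
      ultimately show ?thesis using YI by linarith
    next
      case False
      moreover have "0 \<le> 2 * e * C" using e C by simp
      ultimately show ?thesis using I0 by linarith
    qed
    then show "?E - r \<le> ?I" using e(3) by (simp add: algebra_simps)
  qed
qed

text \<open>The one-sided estimate, applied to the nonnegative functions \<open>C + H\<close> and
  \<open>C - H\<close>, gives both the lower and the upper bound.\<close>

lemma ranked_converges:
  fixes M :: "nat \<Rightarrow> 'a measure" and A :: "nat \<Rightarrow> 'a \<Rightarrow> real \<Rightarrow> nat"
  assumes rm: "\<And>n. random_multisubset (M n) (A n)"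
    and ms: "\<And>n. AE \<omega> in M n. msum (A n \<omega>) \<le> 1"
    and hyp: "\<And>k a b. 1 \<le> k \<Longrightarrow> admissible_intervals k a b \<Longrightarrow>
      ennreal (\<Prod>i<k. (b i - a i) / b i) \<le> liminf (\<lambda>n. \<integral>\<^sup>+\<omega>. (\<Prod>i<k. mcard (A n \<omega>) {a i..b i}) \<partial>M n)"
  shows "seq_converges_in_distribution M (\<lambda>n \<omega>. ranked (A n \<omega>)) (poisson_dirichlet 1)"
  unfolding seq_converges_in_distribution_def
proof (intro conjI allI impI ranked_measurable rm)
  fix k :: nat and g :: "(nat \<Rightarrow> real) \<Rightarrow> real"
  assume "continuous_on ({..<k} \<rightarrow>\<^sub>E UNIV) g \<and> bounded (g ` ({..<k} \<rightarrow>\<^sub>E UNIV))"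
  then have g: "continuous_on ({..<k} \<rightarrow>\<^sub>E UNIV) g" and "bounded (g ` ({..<k} \<rightarrow>\<^sub>E UNIV))" by auto
  then obtain C where C: "\<And>x. x \<in> {..<k} \<rightarrow>\<^sub>E UNIV \<Longrightarrow> \<bar>g x\<bar> \<le> C" by (auto simp: bounded_iff)
  define H where "H x = g (restrict x {..<k})" for x
  have HC: "\<bar>H x\<bar> \<le> C" for x unfolding H_def by (intro C) (simp add: restrict_PiE_iff)
  \<comment> \<open>Coordinates from \<open>k\<close> on are constantly \<open>undefined\<close>,
    the others are projections.\<close>
  have "continuous_on UNIV (\<lambda>x :: nat \<Rightarrow> real. restrict x {..<k})"
  proof (rule continuous_on_coordinatewise_then_product)
    fix i
    show "continuous_on UNIV (\<lambda>x :: nat \<Rightarrow> real. restrict x {..<k} i)"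
      by (cases "i < k") (auto intro!: continuous_on_product_coordinates)
  qed
  then have Hcont: "continuous_on UNIV H"
    unfolding H_def by (rule continuous_on_compose2[OF g]) (simp add: image_subset_iff restrict_PiE_iff)
  have [measurable]: "H \<in> borel_measurable borel" using Hcont by (rule borel_measurable_continuous_onI)
  note [measurable] = ranked_measurable[OF random_multisubset_stick_multiset] ranked_measurable[OF rm]
  interpret U: prob_space uniform01_seq by (rule prob_space_uniform01_seq)
  let ?E = "\<integral>u. H (ranked (stick_multiset u)) \<partial>uniform01_seq"
  let ?I = "\<lambda>n. \<integral>\<omega>. H (ranked (A n \<omega>)) \<partial>M n"
  have PD: "(\<integral>x. H x \<partial>poisson_dirichlet 1) = ?E"
    unfolding poisson_dirichlet_def stick_multiset_def[symmetric]
    by (subst integral_distr) auto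
  have intU: "integrable uniform01_seq (\<lambda>u. H (ranked (stick_multiset u)))"
    by (intro U.integrable_const_bound[where B=C]) (use HC in auto)
  have P: "prob_space (M n)" for n using rm by (simp add: random_multisubset_def)
  have intM: "integrable (M n) (\<lambda>\<omega>. H (ranked (A n \<omega>)))" for n
  proof -
    interpret prob_space "M n" by (rule P)
    show ?thesis by (intro integrable_const_bound[where B=C]) (use HC in auto)
  qed
  have shift: "(\<integral>u. C + H (ranked (stick_multiset u)) \<partial>uniform01_seq) = C + ?E"
      "(\<integral>u. C - H (ranked (stick_multiset u)) \<partial>uniform01_seq) = C - ?E"
    using intU by (simp_all add: U.prob_space)
  have shiftM: "(\<integral>\<omega>. C + H (ranked (A n \<omega>)) \<partial>M n) = C + ?I n"
      "(\<integral>\<omega>. C - H (ranked (A n \<omega>)) \<partial>M n) = C - ?I n" for n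
  proof -
    interpret prob_space "M n" by (rule P)
    show "(\<integral>\<omega>. C + H (ranked (A n \<omega>)) \<partial>M n) = C + ?I n"
      "(\<integral>\<omega>. C - H (ranked (A n \<omega>)) \<partial>M n) = C - ?I n"
      using intM[of n] by (simp_all add: prob_space)
  qed
  have bounds: "0 \<le> C + H x" "C + H x \<le> 2 * C" "0 \<le> C - H x" "C - H x \<le> 2 * C" for x
    using HC[of x] by (auto simp: abs_le_iff)
  have "?I \<longlonglongrightarrow> ?E"
  proof (rule tendstoI)
    fix r :: real assume r: "0 < r"
    have "eventually (\<lambda>n. C + ?E - r/2 \<le> C + ?I n) sequentially"
      using expectation_ranked_eventually_ge[OF rm ms hyp, of "\<lambda>x. C + H x" "2 * C" "r/2"] bounds r Hcont
      by (simp add: shift shiftM continuous_intros)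
    moreover have "eventually (\<lambda>n. C - ?E - r/2 \<le> C - ?I n) sequentially"
      using expectation_ranked_eventually_ge[OF rm ms hyp, of "\<lambda>x. C - H x" "2 * C" "r/2"] bounds r Hcont
      by (simp add: shift shiftM continuous_intros)
    ultimately show "eventually (\<lambda>n. dist (?I n) ?E < r) sequentially"
    proof eventually_elim
      case (elim n)
      then show ?case using r unfolding dist_real_def abs_less_iff by linarith
    qed
  qed
  then show "(\<lambda>n. \<integral>\<omega>. g (restrict (ranked (A n \<omega>)) {..<k}) \<partial>M n)
      \<longlonglongrightarrow> (\<integral>x. g (restrict x {..<k}) \<partial>poisson_dirichlet 1)"
    using PD by (simp add: H_def)
qed

theorem lemma2:
  fixes M :: "nat \<Rightarrow> 'a measure" and A :: "nat \<Rightarrow> 'a \<Rightarrow> real \<Rightarrow> nat"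
  assumes "\<And>n. random_multisubset (M n) (A n)"
    and "\<And>n. measure (M n) {\<omega> \<in> space (M n). msum (A n \<omega>) \<le> 1} = 1"
  shows "((\<forall>k\<ge>1. \<forall>a b. admissible_intervals k a b \<longrightarrow>
            liminf (\<lambda>n. \<integral>\<^sup>+\<omega>. (\<Prod>i<k. mcard (A n \<omega>) {a i..b i}) \<partial>M n)
              \<ge> ennreal (\<Prod>i<k. (b i - a i) / b i))
          \<longrightarrow> seq_converges_in_distribution M (\<lambda>n \<omega>. ranked (A n \<omega>)) (poisson_dirichlet 1))
       \<and> ((\<forall>k\<ge>1. \<forall>a b. admissible_intervals k a b \<longrightarrow>
            liminf (\<lambda>n. \<integral>\<^sup>+\<omega>. (\<Prod>i<k. mcard (A n \<omega>) {a i..b i}) \<partial>M n)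
              \<ge> ennreal (\<Prod>i<k. ln (b i / a i)))
          \<longrightarrow> seq_converges_in_distribution M (\<lambda>n \<omega>. ranked (A n \<omega>)) (poisson_dirichlet 1))"
proof -
  have ms: "AE \<omega> in M n. msum (A n \<omega>) \<le> 1" for n
  proof -
    interpret prob_space "M n" using assms(1) by (simp add: random_multisubset_def)
    \<comment> \<open>A nonmeasurable set has \<open>measure\<close> 0, so the value 1 forces
      measurability.\<close>
    have "{\<omega> \<in> space (M n). msum (A n \<omega>) \<le> 1} \<in> sets (M n)"
      using assms(2)[of n] measure_notin_sets by fastforce
    then have "AE \<omega> in M n. \<omega> \<in> {\<omega> \<in> space (M n). msum (A n \<omega>) \<le> 1}"
      using prob_eq_1 assms(2)[of n] by blast
    then show ?thesis by (rule AE_mp) auto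
  qed
  \<comment> \<open>The logarithmic lower bound dominates the other one factor by factor, so both
    claims follow from \<open>ranked_converges\<close>.\<close>
  have le: "ennreal (\<Prod>i<k. (b i - a i) / b i) \<le> ennreal (\<Prod>i<k. ln (b i / a i))"
    if "admissible_intervals k a b" for k a b
  proof (intro ennreal_leI prod_mono conjI)
    fix i assume "i \<in> {..<k}"
    then have "a i \<le> b i" "{a i..b i} \<subseteq> {0<..1}" using that by (auto simp: admissible_intervals_def)
    then have "0 < a i" "a i \<le> b i" by (auto dest: subsetD[of _ _ "a i"])
    then show "0 \<le> (b i - a i) / b i" "(b i - a i) / b i \<le> ln (b i / a i)"
      by (auto intro!: ln_ge_one_minus_div)
  qed
  show ?thesis
    using le by (intro conjI impI ranked_converges assms(1) ms) (blast intro: order_trans)+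
qed

end
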